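(* Let $n$ be an odd positive integer and let $\Gamma$ be a non-trivial strongly regular $n$-bicirculant. Then for every vertex $x$ of $\Gamma$, the graph $\Gamma$ is not locally $3$-isoregular at $x$.
   Context: All graphs are finite, simple and undirected. A strongly regular graph with parameters $(N,k,\lambda,\mu)$ is a $k$-regular graph on $N$ vertices in which every pair of adjacent vertices has exactly $\lambda$ common neighbours and every pair of distinct non-adjacent vertices has exactly $\mu$ common neighbours; it is non-trivial if both it and its complement are connected. An $n$-bicirculant is a graph on $2n$ vertices admitting an automorphism whose cycle decomposition consists of exactly two cycles, each of length $n$. For a set $T$ of vertices, a neighbour of $T$ is a vertex adjacent to every vertex of $T$, and the valency of $T$ is the number of neighbours of $T$. An ordered pair $(x,y)$ of distinct vertices is called $3$-isoregular if, for all vertices $z\neq x,y$, the valency of $\{x,y,z\}$ depends only on the isomorphism type of the subgraph induced on $\{x,y,z\}$. A graph $\Gamma$ is locally $3$-isoregular at a vertex $x$ if there exist a vertex $y$ adjacent to $x$ and a vertex $z\ne x$ not adjacent to $x$ such that both $(x,y)$ and $(x,z)$ are $3$-isoregular. *)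

theory Defs
  imports
    "Graph_Theory.Digraph_Component"
    "Graph_Theory.Digraph_Isomorphism"
    "HOL-Combinatorics.Orbits"
begin

text \<open>
  Finite simple undirected graphs are the records satisfying the locale predicate
  \<^const>\<open>pair_graph\<close>: the arc relation is symmetric and irreflexive, an edge \<open>uv\<close> being
  represented by the two arcs \<open>(u, v)\<close> and \<open>(v, u)\<close>.
\<close>

definition neighbours :: "'a pair_pre_digraph \<Rightarrow> 'a set \<Rightarrow> 'a set" where
  "neighbours G T = {v \<in> pverts G. \<forall>t\<in>T. (v, t) \<in> parcs G}"

definition valency :: "'a pair_pre_digraph \<Rightarrow> 'a set \<Rightarrow> nat" where
  "valency G T = card (neighbours G T)"

definition complement_graph :: "'a pair_pre_digraph \<Rightarrow> 'a pair_pre_digraph" where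
  "complement_graph G =
    \<lparr> pverts = pverts G,
      parcs = {(u, v). u \<in> pverts G \<and> v \<in> pverts G \<and> u \<noteq> v \<and> (u, v) \<notin> parcs G} \<rparr>"

definition strongly_regular :: "'a pair_pre_digraph \<Rightarrow> nat \<Rightarrow> nat \<Rightarrow> nat \<Rightarrow> nat \<Rightarrow> bool" where
  "strongly_regular G N k l m \<longleftrightarrow>
    pair_graph G \<and>
    card (pverts G) = N \<and>
    (\<forall>u \<in> pverts G. valency G {u} = k) \<and>
    (\<forall>u \<in> pverts G. \<forall>v \<in> pverts G. (u, v) \<in> parcs G \<longrightarrow> valency G {u, v} = l) \<and>
    (\<forall>u \<in> pverts G. \<forall>v \<in> pverts G. u \<noteq> v \<and> (u, v) \<notin> parcs G \<longrightarrow> valency G {u, v} = m)"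

definition nontrivial :: "'a pair_pre_digraph \<Rightarrow> bool" where
  "nontrivial G \<longleftrightarrow>
    Digraph_Component.connected (with_proj G) \<and>
    Digraph_Component.connected (with_proj (complement_graph G))"

definition automorphism :: "'a pair_pre_digraph \<Rightarrow> ('a \<Rightarrow> 'a) \<Rightarrow> bool" where
  "automorphism G f \<longleftrightarrow>
    f permutes pverts G \<and>
    (\<forall>u \<in> pverts G. \<forall>v \<in> pverts G. (f u, f v) \<in> parcs G \<longleftrightarrow> (u, v) \<in> parcs G)"

text \<open>The vertex sets of the cycles of \<open>f\<close>, fixed vertices included, are its orbits on the vertices.\<close>

definition bicirculant :: "nat \<Rightarrow> 'a pair_pre_digraph \<Rightarrow> bool" where
  "bicirculant n G \<longleftrightarrow>
    pair_graph G \<and>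
    card (pverts G) = 2 * n \<and>
    (\<exists>f. automorphism G f \<and>
         card (orbit f ` pverts G) = 2 \<and>
         (\<forall>C \<in> orbit f ` pverts G. card C = n))"

text \<open>
  Isomorphism types are those of unlabelled graphs: the isomorphism between the two induced
  subgraphs need not fix \<open>x\<close> and \<open>y\<close>.
\<close>

definition isoregular3_pair :: "'a pair_pre_digraph \<Rightarrow> 'a \<Rightarrow> 'a \<Rightarrow> bool" where
  "isoregular3_pair G x y \<longleftrightarrow>
    x \<in> pverts G \<and> y \<in> pverts G \<and> x \<noteq> y \<and>
    (\<forall>z \<in> pverts G - {x, y}. \<forall>w \<in> pverts G - {x, y}.
       digraph_iso (with_proj G \<restriction> {x, y, z}) (with_proj G \<restriction> {x, y, w}) \<longrightarrow>
       valency G {x, y, z} = valency G {x, y, w})"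

definition locally_3_isoregular :: "'a pair_pre_digraph \<Rightarrow> 'a \<Rightarrow> bool" where
  "locally_3_isoregular G x \<longleftrightarrow>
    (\<exists>y \<in> pverts G. (x, y) \<in> parcs G \<and> isoregular3_pair G x y) \<and>
    (\<exists>z \<in> pverts G. z \<noteq> x \<and> (x, z) \<notin> parcs G \<and> isoregular3_pair G x z)"

end

theory Submission
  imports
    Defs
    "HOL-Number_Theory.Number_Theory"
    "HOL-Computational_Algebra.Polynomial"
begin

text \<open>
  Let \<open>R\<close>, \<open>S\<close>, \<open>T\<close> be the symbol of the bicirculant, viewed in the group ring of \<open>\<int>/n\<close>, let
  \<open>w = \<lambda> - \<mu>\<close> and let \<open>D\<close> be the difference of the two non-principal eigenvalues, which are integers
  because the two orbits form an equitable partition. Strong regularity says that the \<open>2 \<times> 2\<close> matrix with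
  rows \<open>(R, T)\<close>, \<open>(T', S)\<close> satisfies a quadratic equation, and this forces the trace
  \<open>a = R + S - w\<close> to satisfy \<open>a\<^sup>3 = D\<^sup>2 a\<close> modulo \<open>1 + x + \<dots> + x\<^bsup>n - 1\<^esup>\<close>. Comparing
  \<open>a(x)\<^sup>p\<close> with \<open>a(x\<^sup>p)\<close> modulo a prime \<open>p\<close> shows, for \<open>p\<close> prime to \<open>2nD\<close>, that \<open>a\<close> is invariant under
  multiplication by \<open>p\<close>, so that \<open>a(g)\<close> depends only on \<open>gcd g n\<close>; for odd \<open>p\<close> dividing \<open>D\<close> it shows that
  \<open>a\<close> is constant off \<open>0\<close> or periodic modulo \<open>n/p\<close>. Descending in this way, \<open>a\<close> turns out to be constant
  off a subgroup and constant on it, and arithmetic leaves only the parameters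
  \<open>n = 2s\<^sup>2 + 2s + 1\<close>, \<open>k = s(2s + 1)\<close>, \<open>\<lambda> = s\<^sup>2 - 1\<close>, \<open>\<mu> = s\<^sup>2\<close> with \<open>s\<close> any integer (negative \<open>s\<close> gives
  the complements), those of the Hoffman--Singleton graph and those of its complement.

  A 3-isoregular pair yields an equitable partition of the graph, whose quotient contributes one further
  eigenvalue; for the parameters above its integrality forces \<open>s\<close> to be odd if the pair is an edge and
  even if it is not an edge.
\<close>

section \<open>Polynomials modulo the cyclic sum\<close>

definition cyclic_sum :: "nat \<Rightarrow> int poly" where
  "cyclic_sum m = (\<Sum>i<m. monom 1 i)"

definition residue_poly :: "nat \<Rightarrow> (int \<Rightarrow> int) \<Rightarrow> int poly" where
  "residue_poly m a = (\<Sum>i<m. monom (a (int i)) i)"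

text \<open>Modulo \<open>1 + x + ... + x^(m - 1)\<close> instead of \<open>x^m - 1\<close> the
  constant functions vanish, and with them the all-ones term of the path counts; functions on the
  residues are seen up to an additive constant.\<close>

definition cyclic_cong :: "nat \<Rightarrow> int poly \<Rightarrow> int poly \<Rightarrow> bool" where
  "cyclic_cong m f h \<longleftrightarrow> cyclic_sum m dvd f - h"

definition periodic :: "nat \<Rightarrow> (int \<Rightarrow> int) \<Rightarrow> bool" where
  "periodic m a \<longleftrightarrow> (\<forall>g. a (g mod int m) = a g)"

definition convolution :: "nat \<Rightarrow> (int \<Rightarrow> int) \<Rightarrow> (int \<Rightarrow> int) \<Rightarrow> int \<Rightarrow> int" where
  "convolution m a b g = (\<Sum>i<m. a (int i) * b (g - int i))"

lemma cyclic_cong_refl [simp]: "cyclic_cong m f f"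
  by (simp add: cyclic_cong_def)

lemma cyclic_cong_sym: "cyclic_cong m f h \<Longrightarrow> cyclic_cong m h f"
  unfolding cyclic_cong_def using dvd_minus_iff[of "cyclic_sum m" "f - h"] by simp

lemma cyclic_cong_trans [trans]:
  "cyclic_cong m f g \<Longrightarrow> cyclic_cong m g h \<Longrightarrow> cyclic_cong m f h"
  unfolding cyclic_cong_def using dvd_add[of "cyclic_sum m" "f - g" "g - h"] by simp

lemma cyclic_cong_add:
  "cyclic_cong m f g \<Longrightarrow> cyclic_cong m f' g' \<Longrightarrow> cyclic_cong m (f + f') (g + g')"
  unfolding cyclic_cong_def using dvd_add[of "cyclic_sum m" "f - g" "f' - g'"] by (simp add: add_diff_add)

lemma cyclic_cong_diff:
  "cyclic_cong m f g \<Longrightarrow> cyclic_cong m f' g' \<Longrightarrow> cyclic_cong m (f - f') (g - g')"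
proof -
  assume a: "cyclic_cong m f g" "cyclic_cong m f' g'"
  have "f - f' - (g - g') = (f - g) - (f' - g')" by simp
  with a show ?thesis unfolding cyclic_cong_def by (metis dvd_diff)
qed

lemma cyclic_cong_mult:
  assumes "cyclic_cong m f g" "cyclic_cong m f' g'"
  shows "cyclic_cong m (f * f') (g * g')"
proof -
  have "f * f' - g * g' = (f - g) * f' + g * (f' - g')" by (simp add: algebra_simps)
  with assms show ?thesis unfolding cyclic_cong_def by (metis dvd_add dvd_mult dvd_mult2)
qed

lemma cyclic_cong_power: "cyclic_cong m f g \<Longrightarrow> cyclic_cong m (f ^ k) (g ^ k)"
  by (induction k) (auto intro: cyclic_cong_mult)

lemma cyclic_cong_sum:
  "(\<And>i. i \<in> I \<Longrightarrow> cyclic_cong m (f i) (g i)) \<Longrightarrow> cyclic_cong m (sum f I) (sum g I)"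
  by (induction I rule: infinite_finite_induct) (auto intro: cyclic_cong_add)

lemma coeff_residue_poly: "coeff (residue_poly m a) i = (if i < m then a (int i) else 0)"
  by (simp add: residue_poly_def coeff_sum)

lemma cyclic_sum_eq: "cyclic_sum m = residue_poly m (\<lambda>_. 1)"
  by (simp add: cyclic_sum_def residue_poly_def)

lemma cyclic_sum_mult_X_minus_1: "cyclic_sum m * (monom 1 1 - 1) = monom 1 m - 1"
proof (induction m)
  case 0
  then show ?case by (simp add: cyclic_sum_def)
next
  case (Suc m)
  have "cyclic_sum (Suc m) * (monom 1 1 - 1) = (monom 1 m - 1) + monom 1 m * (monom 1 1 - 1)"
    using Suc by (simp add: cyclic_sum_def algebra_simps)
  also have "\<dots> = monom 1 (Suc m) - 1" by (simp add: algebra_simps mult_monom)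
  finally show ?case .
qed

lemma cyclic_cong_monom_period: "cyclic_cong m (monom 1 m) 1"
  unfolding cyclic_cong_def using cyclic_sum_mult_X_minus_1 by (metis dvd_triv_left)

lemma cyclic_cong_monom: "cyclic_cong m (monom c i) (monom c (i mod m))"
proof -
  have *: "monom (c::int) (i mod m + m * (i div m)) = monom c (i mod m) * monom 1 m ^ (i div m)"
    by (simp add: monom_power mult_monom)
  have "cyclic_cong m (monom c (i mod m) * monom 1 m ^ (i div m)) (monom c (i mod m) * 1 ^ (i div m))"
    by (intro cyclic_cong_mult cyclic_cong_refl cyclic_cong_power cyclic_cong_monom_period)
  then show ?thesis using * by simp
qed

text \<open>The degree of \<open>residue_poly m a\<close> is at most that of
  \<open>cyclic_sum m\<close>, so the quotient is a number. This is the way back from congruences to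
  values.\<close>

lemma cyclic_cong_residue_poly_0_imp_const:
  assumes "m > 0" "cyclic_cong m (residue_poly m a) 0"
  shows "\<exists>c. \<forall>i<m. a (int i) = c"
proof -
  obtain q where q: "residue_poly m a = cyclic_sum m * q"
    using assms by (auto simp: cyclic_cong_def dvd_def)
  have degS: "degree (cyclic_sum m) = m - 1"
  proof (rule antisym)
    show "degree (cyclic_sum m) \<le> m - 1"
      by (rule degree_le) (auto simp: cyclic_sum_eq coeff_residue_poly)
    show "m - 1 \<le> degree (cyclic_sum m)"
      by (rule le_degree) (use assms in \<open>auto simp: cyclic_sum_eq coeff_residue_poly\<close>)
  qed
  have degR: "degree (residue_poly m a) \<le> m - 1"
    by (rule degree_le) (auto simp: coeff_residue_poly)
  have "degree q = 0"
  proof (cases "q = 0")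
    case False
    have "cyclic_sum m \<noteq> 0"
      using assms(1) coeff_residue_poly[of m "\<lambda>_. 1" 0] by (auto simp: cyclic_sum_eq)
    then have "degree (residue_poly m a) = (m - 1) + degree q"
      using False by (simp add: q degree_mult_eq degS)
    then show ?thesis using degR by simp
  qed simp
  then obtain c where "q = [:c:]" by (metis degree_eq_zeroE)
  then have "residue_poly m a = smult c (cyclic_sum m)" by (simp add: q)
  then have "\<forall>i<m. a (int i) = c"
    by (metis coeff_residue_poly coeff_smult cyclic_sum_eq mult.right_neutral)
  then show ?thesis by blast
qed

lemma cyclic_cong_residue_poly_const: "cyclic_cong m (residue_poly m (\<lambda>_. c)) 0"
proof -
  have "residue_poly m (\<lambda>_. c) = smult c (cyclic_sum m)"
    by (rule poly_eqI) (simp add: coeff_residue_poly cyclic_sum_eq)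
  then show ?thesis by (simp add: cyclic_cong_def dvd_smult)
qed

lemma residue_poly_cong: "(\<And>i. i < m \<Longrightarrow> a (int i) = b (int i)) \<Longrightarrow> residue_poly m a = residue_poly m b"
  by (simp add: residue_poly_def)

lemma residue_poly_add: "residue_poly m a + residue_poly m b = residue_poly m (\<lambda>g. a g + b g)"
  by (rule poly_eqI) (simp add: coeff_residue_poly)

lemma residue_poly_diff: "residue_poly m a - residue_poly m b = residue_poly m (\<lambda>g. a g - b g)"
  by (rule poly_eqI) (simp add: coeff_residue_poly)

lemma residue_poly_of_int_mult: "of_int c * residue_poly m a = residue_poly m (\<lambda>g. c * a g)"
  by (rule poly_eqI) (simp add: coeff_residue_poly of_int_poly)

lemma residue_poly_delta: "m > 0 \<Longrightarrow> residue_poly m (\<lambda>g. c * of_bool (int m dvd g)) = of_int c"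
proof (rule poly_eqI)
  fix i assume "m > 0"
  have "int m dvd int i \<longleftrightarrow> i = 0" if "i < m" using that by (auto dest: zdvd_imp_le)
  then show "coeff (residue_poly m (\<lambda>g. c * of_bool (int m dvd g))) i = coeff (of_int c) i"
    using \<open>m > 0\<close> by (auto simp: coeff_residue_poly of_int_poly coeff_pCons split: nat.splits)
qed

lemma residue_poly_1: "m > 0 \<Longrightarrow> residue_poly m (\<lambda>g. of_bool (int m dvd g)) = 1"
  using residue_poly_delta[of m 1] by simp

text \<open>Since \<open>x^m\<close> is congruent to 1, exponents count only modulo
  \<open>m\<close>. Products, shifts and the substitution of \<open>x^p\<close> for \<open>x\<close>
  all follow from this reduction.\<close>

lemma cyclic_cong_sum_monom:
  assumes "m > 0" "finite I"
  shows "cyclic_cong m (\<Sum>j\<in>I. monom (c j) (e j))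
           (residue_poly m (\<lambda>g. \<Sum>j\<in>{j\<in>I. int (e j) mod int m = g mod int m}. c j))"
proof -
  have "cyclic_cong m (\<Sum>j\<in>I. monom (c j) (e j)) (\<Sum>j\<in>I. monom (c j) (e j mod m))"
    by (intro cyclic_cong_sum cyclic_cong_monom)
  also have "(\<Sum>j\<in>I. monom (c j) (e j mod m)) =
      residue_poly m (\<lambda>g. \<Sum>j\<in>{j\<in>I. int (e j) mod int m = g mod int m}. c j)"
  proof (rule poly_eqI)
    fix i
    have "coeff (\<Sum>j\<in>I. monom (c j) (e j mod m)) i = (\<Sum>j\<in>I. if e j mod m = i then c j else 0)"
      by (simp add: coeff_sum)
    also have "\<dots> = (\<Sum>j\<in>{j\<in>I. e j mod m = i}. c j)"
      using assms by (simp add: sum.inter_filter)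
    also have "\<dots> = coeff (residue_poly m (\<lambda>g. \<Sum>j\<in>{j\<in>I. int (e j) mod int m = g mod int m}. c j)) i"
    proof (cases "i < m")
      case True
      then have "{j\<in>I. e j mod m = i} = {j\<in>I. int (e j) mod int m = int i mod int m}"
        by (auto simp flip: zmod_int)
      with True show ?thesis by (simp add: coeff_residue_poly)
    next
      case False
      then have *: "{j\<in>I. e j mod m = i} = {}" using assms by auto
      show ?thesis unfolding * using False by (simp add: coeff_residue_poly)
    qed
    finally show "coeff (\<Sum>j\<in>I. monom (c j) (e j mod m)) i =
      coeff (residue_poly m (\<lambda>g. \<Sum>j\<in>{j\<in>I. int (e j) mod int m = g mod int m}. c j)) i" .
  qed
  finally show ?thesis .
qed

lemma cyclic_cong_ex_residue_poly:
  assumes "m > 0"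
  shows "\<exists>z. cyclic_cong m f (residue_poly m z)"
proof -
  have "f = (\<Sum>j\<in>{..degree f}. monom (coeff f j) j)" by (simp add: poly_as_sum_of_monoms)
  then show ?thesis using cyclic_cong_sum_monom[OF assms, of "{..degree f}" "coeff f" "\<lambda>j. j"] by auto
qed

lemma periodic_mod: "periodic m a \<Longrightarrow> a (g mod int m) = a g"
  by (simp add: periodic_def)

lemma periodic_cong: "periodic m a \<Longrightarrow> g mod int m = h mod int m \<Longrightarrow> a g = a h"
  by (metis periodic_def)

lemma cyclic_cong_residue_poly_mult:
  assumes "m > 0" "periodic m b"
  shows "cyclic_cong m (residue_poly m a * residue_poly m b) (residue_poly m (convolution m a b))"
proof -
  have "residue_poly m a * residue_poly m b =
      (\<Sum>(i,j)\<in>{..<m} \<times> {..<m}. monom (a (int i) * b (int j)) (i + j))"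
    by (simp add: residue_poly_def sum_product sum.cartesian_product mult_monom)
  also have "cyclic_cong m \<dots> (residue_poly m
      (\<lambda>g. \<Sum>x\<in>{x\<in>{..<m} \<times> {..<m}. int (fst x + snd x) mod int m = g mod int m}. a (int (fst x)) * b (int (snd x))))"
    using cyclic_cong_sum_monom[OF assms(1), of "{..<m} \<times> {..<m}" "\<lambda>x. a (int (fst x)) * b (int (snd x))" "\<lambda>x. fst x + snd x"]
    by (simp add: case_prod_unfold)
  also have "residue_poly m
      (\<lambda>g. \<Sum>x\<in>{x\<in>{..<m} \<times> {..<m}. int (fst x + snd x) mod int m = g mod int m}. a (int (fst x)) * b (int (snd x)))
      = residue_poly m (convolution m a b)"
  proof (rule residue_poly_cong)
    fix k assume "k < m"
    let ?g = "int k"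
    have *: "b (int (snd x)) = b (?g - int (fst x))"
      if "int (fst x + snd x) mod int m = ?g mod int m" for x
      using that by (intro periodic_cong[OF assms(2)]) (simp add: mod_eq_dvd_iff algebra_simps)
    show "(\<Sum>x\<in>{x\<in>{..<m} \<times> {..<m}. int (fst x + snd x) mod int m = ?g mod int m}. a (int (fst x)) * b (int (snd x)))
       = convolution m a b ?g"
      unfolding convolution_def
    proof (rule sum.reindex_bij_witness[of _ "\<lambda>i. (i, nat ((?g - int i) mod int m))" fst], goal_cases)
      case (1 x)
      obtain i j where x: "x = (i, j)" by (cases x)
      from 1 x have ij: "i < m" "j < m" "int (i + j) mod int m = ?g mod int m" by auto
      have "(?g - int i) mod int m = int j mod int m"
        using ij(3)[symmetric] by (simp add: mod_eq_dvd_iff algebra_simps)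
      then show ?case using ij x by simp
    next
      case (3 i)
      then show ?case using assms(1) by simp
    next
      case (4 i)
      then show ?case using assms(1) by (auto simp: mod_add_right_eq nat_less_iff)
    next
      case (5 x)
      then have "b (int (snd x)) = b (?g - int (fst x))" by (intro *) simp
      then show ?case by (simp only:)
    qed auto
  qed
  finally show ?thesis .
qed

section \<open>Frobenius congruences modulo a prime\<close>

lemma prime_power_add:
  fixes u v :: "'a :: comm_ring_1"
  assumes "prime (p::nat)"
  shows "\<exists>z. (u + v) ^ p = u ^ p + v ^ p + of_nat p * z"
proof -
  have p: "p > 0" using assms prime_gt_0_nat by blast
  let ?t = "\<lambda>k. of_nat (p choose k) * u ^ k * v ^ (p - k)"
  have "(u + v) ^ p = (\<Sum>k\<le>p. ?t k)" by (simp add: binomial_ring)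
  also have "{..p} = insert 0 (insert p {0<..<p})" using p by auto
  also have "sum ?t \<dots> = u ^ p + v ^ p + (\<Sum>k\<in>{0<..<p}. ?t k)" using p by simp
  finally have 1: "(u + v) ^ p = u ^ p + v ^ p + (\<Sum>k\<in>{0<..<p}. ?t k)" .
  have "of_nat p dvd (\<Sum>k\<in>{0<..<p}. ?t k)"
  proof (rule dvd_sum)
    fix k assume "k \<in> {0<..<p}"
    then have "p dvd (p choose k)" using assms by (intro dvd_choose_prime) auto
    then show "of_nat p dvd ?t k" by (metis dvd_def dvd_mult2 of_nat_mult dvd_triv_left)
  qed
  with 1 show ?thesis by (metis dvd_def)
qed

lemma fermat_int:
  assumes "prime (p::nat)"
  shows "int p dvd c ^ p - c"
proof (induction c rule: int_induct[of _ 0])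
  case base
  then show ?case using assms prime_gt_0_nat by (simp add: power_0_left)
next
  case (step1 i)
  obtain z where "(i + 1) ^ p = i ^ p + 1 ^ p + int p * z" using prime_power_add[OF assms] by blast
  then have "(i + 1) ^ p - (i + 1) = (i ^ p - i) + int p * z" by simp
  with step1 show ?case by (metis dvd_add dvd_triv_left)
next
  case (step2 i)
  obtain z where "(i - 1 + 1) ^ p = (i - 1) ^ p + 1 ^ p + int p * z" using prime_power_add[OF assms] by blast
  then have "(i - 1) ^ p - (i - 1) = (i ^ p - i) - int p * z" by simp
  with step2 show ?case by (metis dvd_diff dvd_triv_left)
qed

text \<open>Induction on the coefficients: \<open>prime_power_add\<close> splits off the constant
  term, which Fermat's little theorem fixes modulo \<open>p\<close>, and the factor \<open>x\<close>
  becomes \<open>x^p\<close>.\<close>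

lemma frobenius_poly:
  fixes f :: "int poly"
  assumes "prime (p::nat)"
  shows "\<exists>z. f ^ p = pcompose f (monom 1 p) + of_nat p * z"
proof (induction f)
  case 0
  then show ?case using assms prime_gt_0_nat[of p] by (intro exI[of _ 0]) (simp add: power_0_left)
next
  case (pCons c f)
  then obtain z where z: "f ^ p = pcompose f (monom 1 p) + of_nat p * z" by blast
  have e: "pCons c f = [:c:] + monom 1 1 * f" by (simp add: monom_Suc)
  obtain y where y: "([:c:] + monom 1 1 * f) ^ p = [:c:] ^ p + (monom 1 1 * f) ^ p + of_nat p * y"
    using prime_power_add[OF assms] by blast
  obtain d where d: "c ^ p = c + int p * d" using fermat_int[OF assms, of c] by (metis dvd_def diff_eq_eq add.commute)
  have "[:c:] ^ p = [:c:] + of_nat p * [:d:]" by (simp add: poly_const_pow d of_nat_poly)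
  moreover have "(monom 1 1 * f) ^ p = monom 1 p * pcompose f (monom 1 p) + of_nat p * (monom 1 p * z)"
    by (simp add: power_mult_distrib z monom_power algebra_simps)
  ultimately have "pCons c f ^ p = pcompose (pCons c f) (monom 1 p) + of_nat p * ([:d:] + monom 1 p * z + y)"
    unfolding pcompose_pCons unfolding e y by (simp only: algebra_simps)
  then show ?case by blast
qed

section \<open>Functions satisfying the cubic equation\<close>

text \<open>The reduced coefficients of \<open>a(x^p)\<close>: sums of \<open>a\<close> over the
  fibres of multiplication by \<open>p\<close>. A fibre is a single residue if \<open>p\<close> is
  coprime to \<open>m\<close>; if \<open>p\<close> divides \<open>m\<close>, it is empty or a coset
  of the multiples of \<open>m div p\<close>.\<close>

definition push_forward :: "nat \<Rightarrow> nat \<Rightarrow> (int \<Rightarrow> int) \<Rightarrow> int \<Rightarrow> int" where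
  "push_forward m p a g = (\<Sum>i\<in>{i. i < m \<and> int (p * i) mod int m = g mod int m}. a (int i))"

lemma periodic_push_forward: "periodic m (push_forward m p a)"
  by (simp add: periodic_def push_forward_def)

text \<open>The hypothesis already admits an error \<open>of_nat p * z\<close>, so that the lemma
  applies to its own result; the prime 2 takes two rounds.\<close>

lemma cyclic_cong_frobenius:
  assumes "m > 0" "prime p" "cyclic_cong m f (residue_poly m a + of_nat p * z)"
  shows "\<exists>z'. cyclic_cong m (f ^ p) (residue_poly m (push_forward m p a) + of_nat p * z')"
proof -
  let ?Y = "residue_poly m a"
  obtain u where u: "(?Y + of_nat p * z) ^ p = ?Y ^ p + (of_nat p * z) ^ p + of_nat p * u"
    using prime_power_add[OF assms(2)] by blast
  obtain v where v: "?Y ^ p = pcompose ?Y (monom 1 p) + of_nat p * v"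
    using frobenius_poly[OF assms(2)] by blast
  obtain l where l: "p = Suc l" using assms(2) by (metis not0_implies_Suc not_prime_0)
  have e: "(?Y + of_nat p * z) ^ p =
      pcompose ?Y (monom 1 p) + of_nat p * (v + z * (of_nat p * z) ^ l + u)"
    unfolding u v by (simp add: l algebra_simps)
  have c: "pcompose (monom c i) (monom 1 p) = monom c (p * i)" for c :: int and i
    by (induction i) (simp_all add: monom_0 monom_Suc pcompose_pCons mult_monom algebra_simps)
  have "pcompose ?Y (monom 1 p) = (\<Sum>i<m. monom (a (int i)) (p * i))"
    unfolding residue_poly_def pcompose_sum by (simp add: c)
  also have "cyclic_cong m \<dots> (residue_poly m (push_forward m p a))"
    using cyclic_cong_sum_monom[OF assms(1), of "{..<m}" "\<lambda>i. a (int i)" "\<lambda>i. p * i"]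
    by (simp add: push_forward_def[abs_def])
  finally have "cyclic_cong m ((?Y + of_nat p * z) ^ p)
      (residue_poly m (push_forward m p a) + of_nat p * (v + z * (of_nat p * z) ^ l + u))"
    unfolding e by (intro cyclic_cong_add cyclic_cong_refl)
  then show ?thesis
    using cyclic_cong_trans[OF cyclic_cong_power[OF assms(3)]] by blast
qed

lemma residue_poly_cong_mod:
  assumes "m > 0" "cyclic_cong m (residue_poly m a + of_nat p * z) (residue_poly m b + of_nat p * z')"
  shows "\<exists>c. \<forall>i<m. int p dvd a (int i) - b (int i) - c"
proof -
  obtain y where y: "cyclic_cong m (z - z') (residue_poly m y)"
    using cyclic_cong_ex_residue_poly[OF assms(1)] by blast
  have "cyclic_cong m (residue_poly m a + of_nat p * z - (residue_poly m b + of_nat p * z'))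
      (residue_poly m b + of_nat p * z' - (residue_poly m b + of_nat p * z'))"
    by (intro cyclic_cong_diff assms cyclic_cong_refl)
  then have "cyclic_cong m (residue_poly m a - residue_poly m b + of_nat p * (z - z')) 0"
    by (simp add: algebra_simps)
  then have 1: "cyclic_cong m 0 (residue_poly m a - residue_poly m b + of_nat p * (z - z'))"
    by (rule cyclic_cong_sym)
  have "cyclic_cong m (residue_poly m a - residue_poly m b + of_nat p * (z - z'))
     (residue_poly m a - residue_poly m b + of_int (int p) * residue_poly m y)"
    using y by (auto intro!: cyclic_cong_add cyclic_cong_mult)
  from cyclic_cong_trans[OF 1 this]
  have "cyclic_cong m (residue_poly m (\<lambda>g. a g - b g + int p * y g)) 0"
    unfolding residue_poly_add residue_poly_diff residue_poly_of_int_mult by (rule cyclic_cong_sym)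
  from cyclic_cong_residue_poly_0_imp_const[OF assms(1) this]
  obtain c where c: "\<And>i. i < m \<Longrightarrow> a (int i) - b (int i) + int p * y (int i) = c" by blast
  have "int p dvd a (int i) - b (int i) - c" if "i < m" for i
  proof -
    have "a (int i) - b (int i) - c = int p * (- y (int i))" using c[OF that] by simp
    then show ?thesis by (metis dvd_triv_left)
  qed
  then show ?thesis by blast
qed

lemma forall_residues:
  assumes "m > 0" "periodic m a" "\<forall>i<m. P (a (int i))"
  shows "P (a g)"
proof -
  have "nat (g mod int m) < m" using assms(1) by (simp add: nat_less_iff)
  then have "P (a (int (nat (g mod int m))))" using assms(3) by blast
  then show ?thesis using assms by (simp add: periodic_mod)
qed

text \<open>For \<open>m > 0\<close> this says that at every \<open>m\<close>-th root of unity other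
  than 1 the value of \<open>residue_poly m a\<close> is 0, \<open>D\<close> or
  \<open>- D\<close>.\<close>

definition cubic :: "nat \<Rightarrow> int \<Rightarrow> (int \<Rightarrow> int) \<Rightarrow> bool" where
  "cubic m D a \<longleftrightarrow> cyclic_cong m (residue_poly m a ^ 3) (of_int (D\<^sup>2) * residue_poly m a)"

lemma cubic_odd_power:
  assumes "cubic m D a"
  shows "cyclic_cong m (residue_poly m a ^ (2 * j + 1)) (of_int (D ^ (2 * j)) * residue_poly m a)"
proof (induction j)
  case 0
  then show ?case by simp
next
  case (Suc j)
  let ?Y = "residue_poly m a"
  have "?Y ^ (2 * Suc j + 1) = ?Y ^ (2 * j + 1) * ?Y ^ 2" by (simp flip: power_add)
  also have "cyclic_cong m \<dots> (of_int (D ^ (2 * j)) * ?Y * ?Y ^ 2)"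
    by (rule cyclic_cong_mult[OF Suc.IH cyclic_cong_refl])
  also have "of_int (D ^ (2 * j)) * ?Y * ?Y ^ 2 = of_int (D ^ (2 * j)) * ?Y ^ 3"
    by (simp add: power3_eq_cube power2_eq_square)
  also have "cyclic_cong m \<dots> (of_int (D ^ (2 * j)) * (of_int (D\<^sup>2) * ?Y))"
    using assms by (intro cyclic_cong_mult cyclic_cong_refl) (simp add: cubic_def)
  also have "of_int (D ^ (2 * j)) * (of_int (D\<^sup>2) * ?Y) = of_int (D ^ (2 * Suc j)) * ?Y"
    by (simp add: power_add power2_eq_square algebra_simps)
  finally show ?case .
qed

text \<open>The \<open>p\<close>-th power is evaluated twice: by Frobenius it is
  \<open>a(x^p)\<close> modulo \<open>p\<close>; by the cubic equation, \<open>p - 1\<close> being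
  even, it is \<open>D^(p - 1) * a\<close>.\<close>

lemma cubic_push_forward:
  assumes "m > 0" "periodic m a" "cubic m D a" "prime p" "odd p"
  shows "\<exists>c. \<forall>g. int p dvd push_forward m p a g - D ^ (p - 1) * a g - c"
proof -
  let ?Y = "residue_poly m a"
  obtain j where j: "p = 2 * j + 1" using assms by (metis oddE)
  obtain z' where z': "cyclic_cong m (?Y ^ p) (residue_poly m (push_forward m p a) + of_nat p * z')"
    using cyclic_cong_frobenius[OF assms(1,4), of ?Y a 0] by auto
  have "cyclic_cong m (?Y ^ p) (residue_poly m (\<lambda>g. D ^ (p - 1) * a g) + of_nat p * 0)"
    using cubic_odd_power[OF assms(3), of j] unfolding residue_poly_of_int_mult by (simp add: j)
  then have "cyclic_cong m (residue_poly m (push_forward m p a) + of_nat p * z')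
       (residue_poly m (\<lambda>g. D ^ (p - 1) * a g) + of_nat p * 0)"
    using z' cyclic_cong_sym cyclic_cong_trans by blast
  from residue_poly_cong_mod[OF assms(1) this]
  obtain c where "\<forall>i<m. int p dvd push_forward m p a (int i) - D ^ (p - 1) * a (int i) - c" by blast
  moreover have "periodic m (\<lambda>g. push_forward m p a g - D ^ (p - 1) * a g - c)"
    using periodic_push_forward[of m p a] assms(2) by (simp add: periodic_def)
  ultimately have "int p dvd push_forward m p a g - D ^ (p - 1) * a g - c" for g
    using forall_residues[of m "\<lambda>g. push_forward m p a g - D ^ (p - 1) * a g - c" "\<lambda>x. int p dvd x"] assms(1)
    by blast
  then show ?thesis by blast
qed

lemma push_forward_coprime:
  assumes "m > 0" "periodic m a" "coprime p m"
  shows "push_forward m p a (int p * g) = a g"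
proof -
  have cp: "coprime (int p) (int m)" using assms(3) by simp
  have "{i. i < m \<and> int (p * i) mod int m = (int p * g) mod int m} = {nat (g mod int m)}"
  proof (intro equalityI subsetI)
    fix i assume "i \<in> {i. i < m \<and> int (p * i) mod int m = (int p * g) mod int m}"
    then have i: "i < m" "int m dvd int p * (int i - g)"
      by (auto simp: mod_eq_dvd_iff algebra_simps)
    then have "int m dvd int i - g"
      using cp by (metis coprime_commute coprime_dvd_mult_right_iff)
    then have "int i mod int m = g mod int m" by (simp add: mod_eq_dvd_iff)
    then have "int i = g mod int m" using i(1) by simp
    then show "i \<in> {nat (g mod int m)}" by (metis nat_int singletonI)
  next
    fix i assume "i \<in> {nat (g mod int m)}"
    then show "i \<in> {i. i < m \<and> int (p * i) mod int m = (int p * g) mod int m}"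
      using assms(1) by (simp add: nat_less_iff mod_mult_right_eq)
  qed
  then show ?thesis using assms by (simp add: push_forward_def periodic_mod)
qed

section \<open>Multipliers coprime to \<open>2 * m * D\<close>\<close>

text \<open>The bound 2 comes from adding two indicator functions; the value at 0 stays free because
  \<open>w\<close> will be subtracted there.\<close>

definition small_off_0 :: "nat \<Rightarrow> (int \<Rightarrow> int) \<Rightarrow> bool" where
  "small_off_0 m a \<longleftrightarrow> (\<forall>g. \<not> int m dvd g \<longrightarrow> a g \<in> {0..2})"

lemma periodic_dvd: "periodic m a \<Longrightarrow> int m dvd g \<Longrightarrow> a g = a 0"
  using periodic_cong[of m a g 0] by (simp add: dvd_eq_mod_eq_0)

lemma small_cong_imp_eq:
  assumes "x \<in> {0..2}" "y \<in> {0..2}" "p \<ge> 3" "p dvd x - y"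
  shows "x = (y::int)"
proof (rule ccontr)
  assume "x \<noteq> y"
  then have "\<bar>p\<bar> \<le> \<bar>x - y\<bar>" using assms(4) by (intro dvd_imp_le_int) auto
  then show False using assms by auto
qed

lemma odd_prime_ge_3: "prime (p::nat) \<Longrightarrow> odd p \<Longrightarrow> p \<ge> 3"
  using prime_ge_2_nat[of p] by (cases "p = 2") auto

text \<open>By Fermat \<open>D^(q - 1)\<close> is 1 modulo \<open>q\<close>, so
  \<open>a h - a (q * h)\<close> is constant modulo \<open>q\<close>, and it vanishes at
  \<open>h = 0\<close>. Small values congruent modulo \<open>q \<ge> 3\<close> are equal.\<close>

lemma multiplier_prime:
  assumes "m > 0" "periodic m a" "small_off_0 m a" "cubic m D a"
    and "prime q" "odd q" "\<not> q dvd m" "\<not> int q dvd D"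
  shows "a (int q * g) = a g"
proof (cases "int m dvd g")
  case True
  then show ?thesis using assms(2) by (metis dvd_mult periodic_dvd)
next
  case False
  have cop: "coprime q m" using assms by (simp add: prime_imp_coprime)
  obtain c where c: "\<And>g. int q dvd push_forward m q a g - D ^ (q - 1) * a g - c"
    using cubic_push_forward[OF assms(1,2,4,5,6)] by blast
  have pw: "int q dvd D ^ (q - 1) - 1"
  proof -
    have "int q dvd D * (D ^ (q - 1) - 1)"
      using fermat_int[OF assms(5), of D] prime_gt_0_nat[OF assms(5)]
      by (cases q) (auto simp: algebra_simps)
    then show ?thesis using assms(5,8) by (metis prime_dvd_mult_iff prime_nat_int_transfer)
  qed
  have main: "int q dvd a h - a (int q * h) - c" for h
  proof -
    have "int q dvd (a h - D ^ (q - 1) * a (int q * h) - c) + (D ^ (q - 1) - 1) * a (int q * h)"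
      using c[of "int q * h"] push_forward_coprime[OF assms(1,2) cop, of h] pw
      by (metis dvd_add dvd_mult2)
    then show ?thesis by (simp add: algebra_simps)
  qed
  have qc: "int q dvd c" using main[of 0] by simp
  have "int q dvd a g - a (int q * g)" using main[of g] qc by (metis diff_add_cancel dvd_add)
  moreover have "\<not> int m dvd int q * g"
    using False cop by (metis coprime_commute coprime_dvd_mult_right_iff coprime_int_iff)
  moreover have "int q \<ge> 3" using odd_prime_ge_3[OF assms(5,6)] by simp
  ultimately show ?thesis
    using small_cong_imp_eq[of "a g" "a (int q * g)" "int q"] False assms(3) by (auto simp: small_off_0_def)
qed

lemma multiplier_coprime:
  assumes "m > 0" "periodic m a" "small_off_0 m a" "cubic m D a"
    and "q > 0" "odd q" "coprime q m" "coprime (int q) D"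
  shows "a (int q * g) = a g"
  using assms(5-8)
proof (induction q arbitrary: g rule: prime_divisors_induct)
  case zero
  then show ?case by simp
next
  case (unit x)
  then show ?case by simp
next
  case (factor p x)
  have p: "prime p" "odd p" using factor by auto
  have "a (int (p * x) * g) = a (int p * (int x * g))" by (simp add: algebra_simps)
  also have "\<dots> = a (int x * g)"
  proof (rule multiplier_prime[OF assms(1-4) p])
    show "\<not> p dvd m"
      using factor.prems(3) p(1) by (metis coprime_common_divisor_nat coprime_mult_left_iff dvd_refl not_prime_1)
    show "\<not> int p dvd D"
      using factor.prems(4) p(1) by (metis coprime_common_divisor coprime_mult_left_iff dvd_refl not_prime_unit of_nat_mult prime_nat_int_transfer)
  qed
  also have "\<dots> = a g" using factor by (intro factor.IH) auto
  finally show ?case .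
qed

text \<open>With \<open>k\<close> the product of the prime factors of \<open>L\<close> that do not
  divide \<open>x\<close>, every prime factor of \<open>L\<close> divides exactly one of
  \<open>x\<close> and \<open>k * m\<close>.\<close>

lemma coprime_lift:
  fixes x m L :: int
  assumes "coprime x m" "L \<noteq> 0"
  shows "\<exists>k. coprime (x + k * m) L"
proof -
  define k where "k = \<Prod>{p. p \<in> prime_factors L \<and> \<not> p dvd x}"
  have "coprime (x + k * m) L"
  proof (rule ccontr)
    assume "\<not> coprime (x + k * m) L"
    then obtain p where p: "prime p" "p dvd x + k * m" "p dvd L"
      using prime_divisor_exists[of "gcd (x + k * m) L"] assms(2)
      by (auto simp: coprime_iff_gcd_eq_1)
    show False
    proof (cases "p dvd x")
      case True
      then have "p dvd k * m" using p(2) by (simp add: dvd_add_right_iff)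
      moreover have "\<not> p dvd m" using True assms(1) p(1) by (meson coprime_common_divisor not_prime_unit)
      ultimately have "p dvd k" using p(1) prime_dvd_mult_iff by blast
      then obtain q where q: "q \<in> prime_factors L" "\<not> q dvd x" "p dvd q"
        unfolding k_def using p(1) by (subst (asm) prime_dvd_prod_iff) auto
      then have "p = q" using p(1) by (metis in_prime_factors_imp_prime primes_dvd_imp_eq)
      then show False using True q by simp
    next
      case False
      then have "p dvd k" unfolding k_def using p assms(2)
        by (intro dvd_prodI) (auto simp: in_prime_factors_iff)
      then show False using p(2) False by (metis dvd_add_left_iff dvd_mult2)
    qed
  qed
  then show ?thesis by blast
qed

text \<open>After division by the common gcd, \<open>g\<close> and \<open>h\<close> differ by a unit
  modulo \<open>m1\<close>, which is lifted to a multiplier that is odd and coprime to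
  \<open>m\<close> and \<open>D\<close>.\<close>

lemma multiplier_gcd:
  assumes "m > 0" "periodic m a" "small_off_0 m a" "cubic m D a" "D \<noteq> 0"
    and "gcd g (int m) = gcd h (int m)"
  shows "a g = a h"
proof -
  define d where "d = gcd g (int m)"
  have d0: "d > 0" using assms(1) by (simp add: d_def)
  define g1 h1 m1 where "g1 = g div d" and "h1 = h div d" and "m1 = int m div d"
  have eqs: "g = d * g1" "h = d * h1" "int m = d * m1"
  proof -
    have "d dvd g" "d dvd int m" by (simp_all add: d_def)
    moreover have "d dvd h" by (simp add: d_def assms(6))
    ultimately show "g = d * g1" "h = d * h1" "int m = d * m1" by (simp_all add: g1_def h1_def m1_def)
  qed
  have cg: "coprime g1 m1"
    unfolding g1_def m1_def d_def using assms(1) by (intro div_gcd_coprime) auto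
  have ch: "coprime h1 m1"
    unfolding h1_def m1_def d_def assms(6) using assms(1) by (intro div_gcd_coprime) auto
  have m1: "m1 > 0" using eqs(3) assms(1) d0 by (metis of_nat_0_less_iff zero_less_mult_pos)
  obtain u where u: "[g1 * u = 1] (mod m1)" using cg cong_solve_coprime_int by blast
  have cu: "coprime u m1" using u by (metis coprime_iff_invertible_int mult.commute)
  have "coprime (u * h1) m1" using cu ch by simp
  then obtain k where k: "coprime (u * h1 + k * m1) (2 * int m * D)"
    using coprime_lift[of "u * h1" m1 "2 * int m * D"] assms(1,5) by auto
  define q0 where "q0 = u * h1 + k * m1"
  \<comment> \<open>Reduction modulo \<open>2 * m * |D|\<close> makes the multiplier nonnegative and
    keeps its residue modulo \<open>m\<close> and its coprimality; it cannot be 0, being coprime to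
    an even number.\<close>
  define q where "q = q0 mod (2 * int m * \<bar>D\<bar>)"
  have L: "2 * int m * \<bar>D\<bar> > 0" using assms(1,5) by simp
  have cq: "coprime q (2 * int m * \<bar>D\<bar>)"
  proof -
    have "coprime q0 (2 * int m * \<bar>D\<bar>)" using k unfolding q0_def by simp
    then show ?thesis unfolding q_def using assms(1,5) by (subst coprime_mod_left_iff) auto
  qed
  have q_nonneg: "q \<ge> 0" unfolding q_def using L by simp
  have "q \<noteq> 0"
  proof
    assume "q = 0"
    then have "2 * int m * \<bar>D\<bar> = 1" using cq L by simp
    then have "even (1::int)" by (metis dvd_triv_left mult.assoc)
    then show False by simp
  qed
  then have q0: "q > 0" using q_nonneg by simp
  have "[q = q0] (mod int m)"
    unfolding q_def cong_def by (simp add: mod_mod_cancel)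
  then have "[q * g = q0 * g] (mod int m)" by (rule cong_mult) simp
  moreover have "[q0 * g = h] (mod int m)"
  proof -
    have "[q0 * g1 = h1] (mod m1)"
    proof -
      have "[q0 * g1 = u * h1 * g1] (mod m1)"
        unfolding q0_def cong_iff_dvd_diff by (simp add: distrib_right)
      also have "u * h1 * g1 = (g1 * u) * h1" by simp
      also have "[(g1 * u) * h1 = 1 * h1] (mod m1)" using u by (rule cong_mult) simp
      finally show ?thesis by simp
    qed
    then have "m1 dvd q0 * g1 - h1" by (simp add: cong_iff_dvd_diff)
    then have "d * m1 dvd d * (q0 * g1 - h1)" by (rule mult_dvd_mono[OF dvd_refl])
    then show ?thesis unfolding cong_iff_dvd_diff by (simp add: eqs algebra_simps)
  qed
  ultimately have "[q * g = h] (mod int m)" by (rule cong_trans)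
  then have "a (q * g) = a h" unfolding cong_def by (rule periodic_cong[OF assms(2)])
  moreover have "a (int (nat q) * g) = a g"
  proof (rule multiplier_coprime[OF assms(1-4)])
    show "nat q > 0" using q0 by simp
    show "odd (nat q)" using cq q0 by (auto simp: even_nat_iff coprime_right_2_iff_odd)
    show "coprime (nat q) m" using cq q0 by (simp flip: coprime_int_iff)
    show "coprime (int (nat q)) D" using cq q0 by simp
  qed
  ultimately show ?thesis using q0 by simp
qed

section \<open>Odd primes dividing \<open>D\<close>: constancy off 0, or descent to a smaller
  modulus\<close>

text \<open>The term \<open>D^(p - 1) * a\<close> vanishes modulo \<open>p\<close>, so every value
  \<open>a h\<close>, read off at \<open>p * h\<close>, is congruent to \<open>c\<close>.\<close>

lemma odd_prime_dvd_imp_const: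
  assumes "m > 0" "periodic m a" "small_off_0 m a" "cubic m D a"
    and "prime p" "odd p" "int p dvd D" "\<not> p dvd m"
  shows "\<exists>c. \<forall>g. \<not> int m dvd g \<longrightarrow> a g = c"
proof -
  have cop: "coprime p m" using assms by (simp add: prime_imp_coprime)
  have p3: "p \<ge> 3" using assms(5,6) by (rule odd_prime_ge_3)
  obtain c where c: "\<And>g. int p dvd push_forward m p a g - D ^ (p - 1) * a g - c"
    using cubic_push_forward[OF assms(1,2,4,5,6)] by blast
  have pD: "int p dvd D ^ (p - 1)" using assms(7) p3 by (intro dvd_trans[OF assms(7)] dvd_power) auto
  have main: "int p dvd a h - c" for h
  proof -
    have "int p dvd (a h - D ^ (p - 1) * a (int p * h) - c) + D ^ (p - 1) * a (int p * h)"
      using c[of "int p * h"] push_forward_coprime[OF assms(1,2) cop, of h] pD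
      by (metis dvd_add dvd_mult2)
    then show ?thesis by simp
  qed
  have "a g = a h" if "\<not> int m dvd g" "\<not> int m dvd h" for g h
  proof (rule small_cong_imp_eq)
    show "int p dvd a g - a h" using dvd_diff[OF main[of g] main[of h]] by simp
    show "int p \<ge> 3" using p3 by simp
  qed (use that assms(3) in \<open>auto simp: small_off_0_def\<close>)
  then show ?thesis by meson
qed

lemma residue_poly_mult_period:
  assumes "periodic M a"
  shows "residue_poly (p * M) a = residue_poly M a * (\<Sum>l<p. monom 1 (M * l))"
proof (induction p)
  case 0
  then show ?case by (simp add: residue_poly_def)
next
  case (Suc p)
  have "residue_poly (Suc p * M) a = residue_poly (p * M) a + (\<Sum>i\<in>{p * M..<Suc p * M}. monom (a (int i)) i)"
    unfolding residue_poly_def by (subst sum.union_disjoint[symmetric]) (auto intro!: sum.cong)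
  also have "(\<Sum>i\<in>{p * M..<Suc p * M}. monom (a (int i)) i) = (\<Sum>i<M. monom (a (int i)) (i + M * p))"
  proof (rule sum.reindex_bij_witness[of _ "\<lambda>i. i + p * M" "\<lambda>i. i - p * M"], goal_cases)
    case (5 i)
    then have "a (int i) = a (int (i - p * M))"
      by (intro periodic_cong[OF assms]) (simp add: of_nat_diff mod_eq_dvd_iff)
    with 5 show ?case by (simp add: mult.commute)
  qed auto
  also have "\<dots> = residue_poly M a * monom 1 (M * p)"
    by (simp add: residue_poly_def sum_distrib_right mult_monom)
  finally show ?case using Suc by (simp add: algebra_simps)
qed

lemma periodic_const [simp]: "periodic m (\<lambda>_. c)"
  by (simp add: periodic_def)

lemma cyclic_cong_dvd: "cyclic_cong (p * M) f g \<Longrightarrow> cyclic_cong M f g"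
  using residue_poly_mult_period[of M "\<lambda>_. 1" p] by (auto simp: cyclic_cong_def cyclic_sum_eq elim: dvd_mult_left)

lemma cyclic_cong_cancel:
  assumes "m > 0" "c \<noteq> 0" "cyclic_cong m (of_int c * f) (of_int c * g)"
  shows "cyclic_cong m f g"
proof -
  obtain z where z: "cyclic_cong m (f - g) (residue_poly m z)"
    using cyclic_cong_ex_residue_poly[OF assms(1)] by blast
  have "cyclic_cong m (residue_poly m (\<lambda>g. c * z g)) (of_int c * (f - g))"
    unfolding residue_poly_of_int_mult[symmetric]
    by (intro cyclic_cong_mult cyclic_cong_refl cyclic_cong_sym[OF z])
  moreover have "cyclic_cong m (of_int c * (f - g)) 0"
    using assms(3) by (simp add: cyclic_cong_def algebra_simps)
  ultimately obtain k where k: "\<And>i. i < m \<Longrightarrow> c * z (int i) = k"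
    using cyclic_cong_residue_poly_0_imp_const[OF assms(1)] cyclic_cong_trans by meson
  have "residue_poly m z = residue_poly m (\<lambda>_. z (int 0))"
    by (rule residue_poly_cong) (use k assms(1,2) in \<open>metis mult_cancel_left\<close>)
  then have "cyclic_cong m (residue_poly m z) 0" using cyclic_cong_residue_poly_const by metis
  with z have "cyclic_cong m (f - g) 0" by (rule cyclic_cong_trans)
  then show ?thesis by (simp add: cyclic_cong_def)
qed

text \<open>Modulo \<open>cyclic_sum M\<close> each \<open>x^(M * l)\<close> is 1, so the polynomial
  of level \<open>p * M\<close> is \<open>p\<close> times that of level \<open>M\<close>, and
  \<open>p^3\<close> cancels from the equation.\<close>

lemma cubic_descent:
  assumes "M > 0" "p > 0" "periodic M a" "cubic (p * M) (int p * D) a"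
  shows "cubic M D a"
proof -
  let ?Y = "residue_poly M a"
  have "cyclic_cong M (\<Sum>l<p. monom 1 (M * l)) (\<Sum>l<p. 1)"
  proof (rule cyclic_cong_sum)
    fix l
    show "cyclic_cong M (monom 1 (M * l)) 1" using cyclic_cong_monom[of M 1 "M * l"] by simp
  qed
  then have "cyclic_cong M (?Y * (\<Sum>l<p. monom 1 (M * l))) (?Y * of_int (int p))"
    by (intro cyclic_cong_mult) auto
  then have Y: "cyclic_cong M (residue_poly (p * M) a) (of_int (int p) * ?Y)"
    unfolding residue_poly_mult_period[OF assms(3)] by (simp add: mult.commute)
  have "cyclic_cong M ((of_int (int p) * ?Y) ^ 3) (residue_poly (p * M) a ^ 3)"
    by (intro cyclic_cong_power cyclic_cong_sym[OF Y])
  also have "cyclic_cong M \<dots> (of_int ((int p * D)\<^sup>2) * residue_poly (p * M) a)"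
    using assms(4) unfolding cubic_def by (rule cyclic_cong_dvd)
  also have "cyclic_cong M \<dots> (of_int ((int p * D)\<^sup>2) * (of_int (int p) * ?Y))"
    by (intro cyclic_cong_mult cyclic_cong_refl Y)
  finally have "cyclic_cong M (of_int (int p ^ 3) * ?Y ^ 3) (of_int (int p ^ 3) * (of_int (D\<^sup>2) * ?Y))"
    by (simp add: power_mult_distrib power2_eq_square power3_eq_cube algebra_simps)
  then show ?thesis unfolding cubic_def by (rule cyclic_cong_cancel[OF assms(1), rotated]) (use assms(2) in simp)
qed

lemma cyclic_cong_shift:
  assumes "m > 0" "periodic m a"
  shows "cyclic_cong m (monom 1 s * residue_poly m a) (residue_poly m (\<lambda>g. a (g - int s)))"
proof -
  have "monom 1 s * residue_poly m a = (\<Sum>i<m. monom (a (int i)) (i + s))"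
    by (simp add: residue_poly_def sum_distrib_left mult_monom add.commute)
  also have "cyclic_cong m \<dots> (residue_poly m (\<lambda>g. \<Sum>j\<in>{j\<in>{..<m}. int (j + s) mod int m = g mod int m}. a (int j)))"
    using cyclic_cong_sum_monom[OF assms(1), of "{..<m}" "\<lambda>i. a (int i)" "\<lambda>i. i + s"] by simp
  also have "residue_poly m (\<lambda>g. \<Sum>j\<in>{j\<in>{..<m}. int (j + s) mod int m = g mod int m}. a (int j))
     = residue_poly m (\<lambda>g. a (g - int s))"
  proof (rule residue_poly_cong)
    fix i
    have "{j\<in>{..<m}. int (j + s) mod int m = int i mod int m} = {nat ((int i - int s) mod int m)}"
    proof (intro equalityI subsetI)
      fix j assume "j \<in> {j\<in>{..<m}. int (j + s) mod int m = int i mod int m}"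
      then have j: "j < m" "int j mod int m = (int i - int s) mod int m"
        unfolding mod_eq_dvd_iff by (auto simp: algebra_simps)
      then show "j \<in> {nat ((int i - int s) mod int m)}" by (metis mod_less nat_int singletonI zmod_int)
    next
      fix j assume "j \<in> {nat ((int i - int s) mod int m)}"
      then show "j \<in> {j\<in>{..<m}. int (j + s) mod int m = int i mod int m}"
        using assms(1) by (simp add: nat_less_iff mod_add_left_eq)
    qed
    then show "(\<Sum>j\<in>{j\<in>{..<m}. int (j + s) mod int m = int i mod int m}. a (int j)) = a (int i - int s)"
      using assms by (simp add: periodic_mod)
  qed
  finally show ?thesis .
qed

text \<open>As \<open>g\<close> lacks the full power of \<open>p\<close> contained in
  \<open>m\<close>, its gcd with \<open>m\<close> divides \<open>M\<close> and therefore also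
  \<open>h\<close>; the roles are symmetric.\<close>

lemma gcd_eq_of_cong:
  fixes g h :: int
  assumes "m > 0" "prime p" "m = p * M" "e = multiplicity p m"
    and "int M dvd g - h" "\<not> int (p ^ e) dvd g" "\<not> int (p ^ e) dvd h"
  shows "gcd g (int m) = gcd h (int m)"
proof -
  have *: "gcd g (int m) dvd gcd h (int m)" if "int M dvd g - h" "\<not> int (p ^ e) dvd g" for g h
  proof -
    obtain k where k: "int m = gcd g (int m) * k" by (metis dvd_def gcd_dvd2)
    have pk: "int p dvd k"
    proof (rule ccontr)
      assume "\<not> int p dvd k"
      then have "coprime (int (p ^ e)) k"
        using assms(2) by (simp add: prime_imp_coprime)
      moreover have "int (p ^ e) dvd gcd g (int m) * k"
        using multiplicity_dvd[of p m] assms(4) k by (metis of_nat_dvd_iff)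
      ultimately have "int (p ^ e) dvd gcd g (int m)" by (simp add: coprime_dvd_mult_left_iff)
      then show False using that(2) by (metis dvd_trans gcd_dvd1)
    qed
    then obtain k' where k': "k = int p * k'" by (auto simp: dvd_def)
    have "int p * int M = int p * (gcd g (int m) * k')" using k k' assms(3) by (simp add: algebra_simps)
    then have "int M = gcd g (int m) * k'" using assms(2) by (metis mult_left_cancel not_prime_0 of_nat_0 of_nat_eq_iff)
    then have "gcd g (int m) dvd int M" by (metis dvd_triv_left)
    then have "gcd g (int m) dvd g - h" using that(1) by (rule dvd_trans)
    from dvd_diff[OF gcd_dvd1 this] have "gcd g (int m) dvd h" by simp
    then show ?thesis by simp
  qed
  have "int M dvd h - g" using assms(5) by (metis dvd_minus_iff minus_diff_eq)
  then show ?thesis using *[of g h] *[of h g] assms(5-7) by (simp add: zdvd_antisym_nonneg)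
qed

lemma coset_sum:
  assumes "M > 0" "p > 0" "0 \<le> g" "g < int M"
  shows "push_forward (p * M) p a (int p * g) = (\<Sum>l<p. a (g + int M * int l))"
  unfolding push_forward_def
proof (rule sum.reindex_bij_witness[of _ "\<lambda>l. nat g + M * l" "\<lambda>i. i div M"], goal_cases)
  case (1 i)
  then have "int M dvd int i - g" using assms(2) by (auto simp: mod_eq_dvd_iff simp flip: right_diff_distrib)
  then have "int i mod int M = g" using assms by (metis mod_eq_dvd_iff mod_pos_pos_trivial)
  then have "nat g = i mod M" by (metis nat_int zmod_int)
  then show ?case by simp
next
  case (2 i)
  then show ?case by (simp add: less_mult_imp_div_less)
next
  case (3 l)
  then show ?case using assms by (simp add: nat_less_iff)
next
  case (4 l)
  have "nat g + M * l < p * M"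
  proof -
    have "nat g + M * l < M + M * l" using assms by (simp add: nat_less_iff)
    also have "\<dots> = M * Suc l" by simp
    also have "\<dots> \<le> M * p" using 4 by (intro mult_le_mono2) simp
    finally show ?thesis by (simp add: mult.commute)
  qed
  moreover have "int (p * (nat g + M * l)) = int p * g + int l * int (p * M)"
    using assms by (simp add: algebra_simps)
  ultimately show ?case using assms(3) by simp
next
  case (5 i)
  then have "int M dvd int i - g" using assms(2) by (auto simp: mod_eq_dvd_iff simp flip: right_diff_distrib)
  then have "int i mod int M = g" using assms by (metis mod_eq_dvd_iff mod_pos_pos_trivial)
  then have "int i = g + int M * int (i div M)" by (metis mult_div_mod_eq zdiv_int add.commute)
  then show ?case by simp
qed

text \<open>A comparison inside the cosets of the multiples of \<open>M\<close> settles the matter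
  once all values are small. The value at 0 may fail to be small; then \<open>a\<close> would be
  periodic modulo \<open>M\<close> up to a correction \<open>\<beta>\<close> at 0, and the cubic
  equation would force \<open>\<beta>\<close> to be 0 or \<open>D\<close> up to sign, against the
  last hypothesis.\<close>

lemma periodic_descent:
  assumes "m > 0" "periodic m a" "small_off_0 m a" "cubic m D a" "D \<noteq> 0"
    and "prime p" "odd p" "m = p * M" "int p dvd D"
    and "a 0 \<in> {0..2} \<or> (\<forall>j\<in>{0..2}. \<bar>a 0 - j\<bar> \<noteq> \<bar>D\<bar>)"
  shows "periodic M a"
proof -
  have p3: "p \<ge> 3" using assms(6,7) by (rule odd_prime_ge_3)
  have M0: "M > 0" using assms(1,8) by auto
  have pm: "int p dvd int m" and Mm: "int M dvd int m" using assms(8) by simp_all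
  define e where "e = multiplicity p m"
  have edvd: "p ^ e dvd m" unfolding e_def by (rule multiplicity_dvd)
  have e_not: "\<not> p ^ e dvd M"
  proof
    assume "p ^ e dvd M"
    then have "p ^ Suc e dvd m" using assms(8) by (simp add: mult_dvd_mono)
    then have "Suc e \<le> multiplicity p m"
      using assms(1,6) by (intro multiplicity_geI) (auto simp: not_prime_unit)
    then show False by (simp add: e_def)
  qed
  have pD: "int p dvd D ^ (p - 1)" using p3 by (intro dvd_trans[OF assms(9)] dvd_power) auto
  obtain c where c: "\<And>g. int p dvd push_forward m p a g - D ^ (p - 1) * a g - c"
    using cubic_push_forward[OF assms(1,2,4,6,7)] by blast
  \<comment> \<open>The residue 1 is not a multiple of \<open>p\<close> modulo \<open>m\<close>, so
    the push-forward vanishes there.\<close>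
  have pc: "int p dvd c"
  proof -
    have empty: "{i. i < m \<and> int (p * i) mod int m = 1 mod int m} = {}"
    proof (intro equals0I)
      fix i assume "i \<in> {i. i < m \<and> int (p * i) mod int m = 1 mod int m}"
      then have "int m dvd int (p * i) - 1" by (simp add: mod_eq_dvd_iff)
      then have "int p dvd int (p * i) - 1" by (rule dvd_trans[OF pm])
      then have "int p dvd int p * int i - 1" by simp
      from dvd_diff[OF dvd_triv_left[of "int p" "int i"] this] have "int p dvd 1" by simp
      then show False using p3 by simp
    qed
    have "push_forward m p a 1 = 0" unfolding push_forward_def empty by simp
    then have "int p dvd - (D ^ (p - 1) * a 1 + c)" using c[of 1] by simp
    then have "int p dvd D ^ (p - 1) * a 1 + c" by (simp only: dvd_minus_iff)
    then show ?thesis using pD by (simp add: dvd_add_right_iff)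
  qed
  have coset: "int p dvd (\<Sum>l<p. a (g + int M * int l))" if "0 \<le> g" "g < int M" for g
  proof -
    have "int p dvd (push_forward m p a (int p * g) - D ^ (p - 1) * a (int p * g) - c)
        + D ^ (p - 1) * a (int p * g) + c"
      using c[of "int p * g"] pD pc by (intro dvd_add dvd_mult2)
    then show ?thesis using coset_sum[OF M0 _ that, of p a] p3 assms(8) by simp
  qed
  have same: "a (g + int M * int l) = a (g + int M * int l')"
    if "\<not> int (p ^ e) dvd g + int M * int l" "\<not> int (p ^ e) dvd g + int M * int l'" for g l l'
  proof (rule multiplier_gcd[OF assms(1-5)], rule gcd_eq_of_cong[OF assms(1,6,8) e_def])
    have "g + int M * int l - (g + int M * int l') = int M * (int l - int l')" by (simp add: algebra_simps)
    then show "int M dvd g + int M * int l - (g + int M * int l')" by simp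
  qed (use that in auto)
  have uniq: "l = l'"
    if "int (p ^ e) dvd g + int M * int l" "int (p ^ e) dvd g + int M * int l'" "l < p" "l' < p" for g l l'
  proof (rule ccontr)
    assume "l \<noteq> l'"
    have "g + int M * int l - (g + int M * int l') = int M * (int l - int l')" by (simp add: algebra_simps)
    then have d: "int (p ^ e) dvd int M * (int l - int l')" using dvd_diff[OF that(1,2)] by simp
    have "\<not> int p dvd int l - int l'"
    proof
      assume "int p dvd int l - int l'"
      then have "\<bar>int p\<bar> \<le> \<bar>int l - int l'\<bar>" using \<open>l \<noteq> l'\<close> by (intro dvd_imp_le_int) auto
      then show False using that(3,4) by linarith
    qed
    then have "coprime (int (p ^ e)) (int l - int l')" using assms(6) by (simp add: prime_imp_coprime)
    then have "int (p ^ e) dvd int M" using d by (simp add: coprime_dvd_mult_left_iff)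
    then show False using e_not by (simp only: of_nat_dvd_iff)
  qed
  have m_not: "a h \<in> {0..2}" if "\<not> int (p ^ e) dvd h" for h
  proof -
    have "\<not> int m dvd h" using that edvd dvd_trans[of "int (p ^ e)" "int m" h] by (simp only: of_nat_dvd_iff) blast
    then show ?thesis using assms(3) by (simp add: small_off_0_def)
  qed
  txt \<open>In each coset of \<open>(m/p)\<int>\<close> all values but at most one agree by the multiplier argument; the
    coset sum being divisible by \<open>p\<close>, the exceptional value is congruent to the common one.\<close>
  have special: "int p dvd a (g + int M * int l0) - a (g + int M * int l)"
    if g: "0 \<le> g" "g < int M" and l: "l0 < p" "l < p" "l \<noteq> l0"
      "int (p ^ e) dvd g + int M * int l0" for g l0 l
  proof -
    have oth: "\<not> int (p ^ e) dvd g + int M * int l'" if "l' < p" "l' \<noteq> l0" for l'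
      using uniq[OF l(4) _ l(1) that(1)] that by blast
    have "(\<Sum>l'<p. a (g + int M * int l')) =
        a (g + int M * int l0) + (\<Sum>l'\<in>{..<p} - {l0}. a (g + int M * int l'))"
      using l by (simp add: sum.remove)
    also have "(\<Sum>l'\<in>{..<p} - {l0}. a (g + int M * int l')) = (\<Sum>l'\<in>{..<p} - {l0}. a (g + int M * int l))"
      using oth l by (intro sum.cong refl same) auto
    also have "\<dots> = int (p - 1) * a (g + int M * int l)" using l by simp
    finally have "int p dvd a (g + int M * int l0) + (int p - 1) * a (g + int M * int l)"
      using coset[OF g] p3 by (simp add: of_nat_diff)
    then have "int p dvd (a (g + int M * int l0) + (int p - 1) * a (g + int M * int l)) - int p * a (g + int M * int l)"
      by (intro dvd_diff) auto
    then show ?thesis by (simp add: algebra_simps)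
  qed
  have special': "a (g + int M * int l0) = a (g + int M * int l)"
    if "0 \<le> g" "g < int M" "l0 < p" "l < p" "l \<noteq> l0" "int (p ^ e) dvd g + int M * int l0"
      "a (g + int M * int l0) \<in> {0..2}" for g l0 l
  proof (rule small_cong_imp_eq[OF that(7) m_not])
    show "\<not> int (p ^ e) dvd g + int M * int l" using uniq[OF that(6) _ that(3,4)] that(5) by blast
    show "int p \<ge> 3" using p3 by simp
  qed (rule special[OF that(1-6)])
  have a0: "a 0 \<in> {0..2}"
  proof (rule ccontr)
    assume a0: "a 0 \<notin> {0..2}"
    define b where "b = a (int M)"
    have onP: "a (int M * int l) = b" if "0 < l" "l < p" for l
    proof -
      have e0: "int (p ^ e) dvd 0 + int M * int 0" by simp
      have "\<not> int (p ^ e) dvd 0 + int M * int l" using uniq[OF e0, of l] that p3 by auto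
      moreover have "\<not> int (p ^ e) dvd 0 + int M * int 1" using uniq[OF e0, of 1] p3 by auto
      ultimately show ?thesis using same[of 0 l 1] by (simp add: b_def)
    qed
    have off: "a (g + int M * int l) = a (g + int M * int l')"
      if "0 < g" "g < int M" "l < p" "l' < p" for g l l'
    proof -
      have nd: "\<not> int m dvd g + int M * int l" for l
      proof
        assume "int m dvd g + int M * int l"
        then have "int M dvd g + int M * int l" by (rule dvd_trans[OF Mm])
        then have "int M dvd g" by (simp add: dvd_add_left_iff)
        then show False using that by (simp add: zdvd_not_zless)
      qed
      then have sm: "a (g + int M * int l) \<in> {0..2}" for l using assms(3) by (simp add: small_off_0_def)
      show ?thesis
      proof (cases "l = l'")
        case False
        show ?thesis
        proof (cases "int (p ^ e) dvd g + int M * int l")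
          case True
          then show ?thesis using special'[of g l l'] sm that False by auto
        next
          case l: False
          show ?thesis
          proof (cases "int (p ^ e) dvd g + int M * int l'")
            case True
            then show ?thesis using special'[of g l' l] sm that False by auto
          next
            case False
            with l show ?thesis by (rule same)
          qed
        qed
      qed simp
    qed
    \<comment> \<open>With the value at 0 replaced by the common value \<open>b\<close> at the other
      multiples of \<open>M\<close>, the function is periodic modulo \<open>M\<close>.\<close>
    define a' where "a' g = (if int m dvd g then b else a g)" for g
    have mdec: "g mod int m = g mod int M + int M * (g div int M mod int p)" for g
      using zmod_zmult2_eq[of "int p" g "int M"] p3 by (simp add: assms(8) mult.commute)
    have a'_coset: "a' g = (if int M dvd g then b else a (g mod int M))" for g
    proof -
      define l where "l = nat (g div int M mod int p)"
      have l: "l < p" "int l = g div int M mod int p" using p3 by (auto simp: l_def nat_less_iff)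
      have ag: "a g = a (g mod int M + int M * int l)"
        using periodic_mod[OF assms(2), of g] mdec[of g] l by simp
      show ?thesis
      proof (cases "int M dvd g")
        case True
        show ?thesis
        proof (cases "int m dvd g")
          case False
          have "l \<noteq> 0"
          proof
            assume "l = 0"
            then have "g mod int m = 0" using mdec[of g] l True by (simp add: dvd_eq_mod_eq_0)
            then show False using False by (simp add: dvd_eq_mod_eq_0)
          qed
          then show ?thesis using ag onP[of l] l True False by (simp add: a'_def dvd_eq_mod_eq_0)
        qed (use True in \<open>simp add: a'_def\<close>)
      next
        case False
        then have "\<not> int m dvd g" using Mm dvd_trans by blast
        moreover have "0 < g mod int M"
        proof -
          have "g mod int M \<noteq> 0" using False by (simp only: dvd_eq_mod_eq_0 not_False_eq_True)
          moreover have "g mod int M \<ge> 0" using M0 by simp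
          ultimately show ?thesis by linarith
        qed
        ultimately show ?thesis using off[of "g mod int M" l 0] ag l False p3 M0 by (simp add: a'_def)
      qed
    qed
    have perM: "a' (g - int M) = a' g" for g
    proof -
      have "int M dvd g - int M \<longleftrightarrow> int M dvd g"
        using dvd_add_left_iff[of "int M" "- int M" g] by simp
      moreover have "(g - int M) mod int M = g mod int M" by simp
      ultimately show ?thesis by (simp add: a'_coset)
    qed
    have perm: "periodic m a'" using assms(2) by (auto simp: periodic_def a'_def dvd_mod_iff)
    define \<beta> where "\<beta> = a 0 - b"
    \<comment> \<open>Multiplication by \<open>?K\<close> annihilates functions of period
      \<open>M\<close>. Hence \<open>?K * ?Y\<close> reduces to \<open>?K * \<beta>\<close>, and the
      cubic equation becomes one for the number \<open>\<beta>\<close>.\<close>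
    let ?Y = "residue_poly m a" and ?Y' = "residue_poly m a'" and ?K = "1 - monom 1 M :: int poly"
    have "?Y = residue_poly m (\<lambda>g. a' g + \<beta> * of_bool (int m dvd g))"
      by (rule residue_poly_cong) (auto simp: a'_def \<beta>_def dest: periodic_dvd[OF assms(2)])
    then have Y: "?Y = ?Y' + of_int \<beta>"
      unfolding residue_poly_add[symmetric] using residue_poly_delta[OF assms(1)] by simp
    have "cyclic_cong m (monom 1 M * ?Y') ?Y'"
      using cyclic_cong_shift[OF assms(1) perm, of M] by (simp add: perM)
    then have "cyclic_cong m (?Y' - monom 1 M * ?Y') (?Y' - ?Y')" by (rule cyclic_cong_diff[OF cyclic_cong_refl])
    then have "cyclic_cong m (?K * ?Y' + ?K * of_int \<beta>) (0 + ?K * of_int \<beta>)"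
      by (intro cyclic_cong_add cyclic_cong_refl) (simp add: algebra_simps)
    then have KY: "cyclic_cong m (?K * ?Y) (?K * of_int \<beta>)" by (simp add: Y algebra_simps)
    have KYn: "cyclic_cong m (?K * ?Y ^ n) (?K * of_int \<beta> ^ n)" for n
    proof (induction n)
      case (Suc n)
      have "cyclic_cong m (?K * ?Y ^ n * ?Y) (?K * of_int \<beta> ^ n * ?Y)"
        by (rule cyclic_cong_mult[OF Suc cyclic_cong_refl])
      also have "?K * of_int \<beta> ^ n * ?Y = of_int \<beta> ^ n * (?K * ?Y)" by (simp add: algebra_simps)
      also have "cyclic_cong m \<dots> (of_int \<beta> ^ n * (?K * of_int \<beta>))"
        by (rule cyclic_cong_mult[OF cyclic_cong_refl KY])
      finally show ?case by (simp add: algebra_simps)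
    qed simp
    have "cyclic_cong m (?K * of_int \<beta> ^ 3) (?K * ?Y ^ 3)" by (rule cyclic_cong_sym[OF KYn])
    also have "cyclic_cong m \<dots> (?K * (of_int (D\<^sup>2) * ?Y))"
      using assms(4) unfolding cubic_def by (rule cyclic_cong_mult[OF cyclic_cong_refl])
    also have "?K * (of_int (D\<^sup>2) * ?Y) = of_int (D\<^sup>2) * (?K * ?Y)" by (simp add: algebra_simps)
    also have "cyclic_cong m \<dots> (of_int (D\<^sup>2) * (?K * of_int \<beta>))"
      by (rule cyclic_cong_mult[OF cyclic_cong_refl KY])
    finally have "cyclic_cong m (?K * of_int \<beta> ^ 3) (of_int (D\<^sup>2) * (?K * of_int \<beta>))" .
    then have "cyclic_cong m (?K * of_int (\<beta> ^ 3 - D\<^sup>2 * \<beta>)) 0"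
      by (simp add: cyclic_cong_def algebra_simps)
    moreover define \<gamma> where "\<gamma> = \<beta> ^ 3 - D\<^sup>2 * \<beta>"
    ultimately have K0: "cyclic_cong m (?K * of_int \<gamma>) 0" by simp
    have K_eq: "?K * of_int \<gamma> = residue_poly m (\<lambda>g. if g = 0 then \<gamma> else if g = int M then - \<gamma> else 0)"
    proof (rule poly_eqI)
      fix i
      have "M < m" using assms(8) M0 p3 by simp
      then show "coeff (?K * of_int \<gamma>) i =
        coeff (residue_poly m (\<lambda>g. if g = 0 then \<gamma> else if g = int M then - \<gamma> else 0)) i"
        using M0 by (auto simp: coeff_residue_poly of_int_poly algebra_simps coeff_pCons split: nat.splits)
    qed
    obtain k where k: "\<And>i. i < m \<Longrightarrow> (if int i = 0 then \<gamma> else if int i = int M then - \<gamma> else 0) = k"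
      using cyclic_cong_residue_poly_0_imp_const[OF assms(1) K0[unfolded K_eq]] by blast
    \<comment> \<open>As \<open>p \<ge> 3\<close>, there is a position besides 0 and
      \<open>M\<close>; its coefficient 0 must equal the coefficient \<open>\<gamma>\<close> at
      0.\<close>
    have "2 * M < m" using assms(8) M0 p3 by simp
    then have "\<gamma> = 0" using k[of 0] k[of "2 * M"] M0 assms(1) by (auto split: if_splits)
    then have "\<beta> * (\<beta>\<^sup>2 - D\<^sup>2) = 0" by (simp add: \<gamma>_def power2_eq_square power3_eq_cube algebra_simps)
    then have cases: "\<beta> = 0 \<or> \<bar>\<beta>\<bar> = \<bar>D\<bar>" by (auto simp: power2_eq_iff)
    have "\<not> int (p ^ e) dvd 0 + int M * int 1" using uniq[of 0 0 1] p3 by auto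
    then have bsm: "b \<in> {0..2}" using m_not[of "int M"] by (simp add: b_def)
    show False using cases bsm a0 assms(10) by (auto simp: \<beta>_def)
  qed
  have sm: "a h \<in> {0..2}" for h
    using a0 assms(3) periodic_dvd[OF assms(2), of h] by (cases "int m dvd h") (auto simp: small_off_0_def)
  have eq0: "a (g + int M * int l) = a g" if "0 \<le> g" "g < int M" "l < p" for g l
  proof (cases "l = 0")
    case False
    show ?thesis
    proof (cases "int (p ^ e) dvd g + int M * int l")
      case True
      then show ?thesis using special'[of g l 0] sm that False by auto
    next
      case l: False
      show ?thesis
      proof (cases "int (p ^ e) dvd g + int M * int 0")
        case True
        then show ?thesis using special'[of g 0 l] sm that False by auto
      next
        case F: False
        show ?thesis using same[OF l F] by simp
      qed
    qed
  qed simp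
  show ?thesis unfolding periodic_def
  proof
    fix g
    define l where "l = nat (g div int M mod int p)"
    have l: "l < p" "int l = g div int M mod int p" using p3 by (auto simp: l_def nat_less_iff)
    have "g mod int m = g mod int M + int M * int l"
      using zmod_zmult2_eq[of "int p" g "int M"] p3 by (simp add: assms(8) mult.commute l)
    then show "a (g mod int M) = a g"
      using eq0[of "g mod int M" l] l M0 periodic_mod[OF assms(2), of g] by simp
  qed
qed

section \<open>The prime 2\<close>

text \<open>Four is the least power of 2 to which the cubic equation applies: it gives
  \<open>a^4 = D^2 * a^2\<close>, which is 0 modulo 2, while two Frobenius steps give
  \<open>a(x^4)\<close>. Multiplication by 4 permutes the residues since \<open>m\<close> is
  odd.\<close>

lemma cubic_even_imp_parity_const:
  assumes "odd m" "periodic m a" "cubic m D a" "even D"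
  shows "\<exists>c. \<forall>g. even (a g - c)"
proof -
  have m0: "m > 0" using assms(1) by (rule odd_pos)
  have cop: "coprime 2 m" using assms(1) by simp
  let ?Y = "residue_poly m a" and ?b = "push_forward m 2 (push_forward m 2 a)"
  obtain z where "cyclic_cong m (?Y ^ 2) (residue_poly m (push_forward m 2 a) + of_nat 2 * z)"
    using cyclic_cong_frobenius[OF m0 two_is_prime_nat, of ?Y a 0] by auto
  then obtain z' where z': "cyclic_cong m ((?Y ^ 2) ^ 2) (residue_poly m ?b + of_nat 2 * z')"
    using cyclic_cong_frobenius[OF m0 two_is_prime_nat] by blast
  obtain E where E: "D = 2 * E" using assms(4) by blast
  have "cyclic_cong m (?Y * ?Y ^ 3) (?Y * (of_int (D\<^sup>2) * ?Y))"
    using assms(3) unfolding cubic_def by (rule cyclic_cong_mult[OF cyclic_cong_refl])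
  moreover have "?Y * ?Y ^ 3 = (?Y ^ 2) ^ 2" by (simp add: power2_eq_square power3_eq_cube)
  moreover have "?Y * (of_int (D\<^sup>2) * ?Y) = residue_poly m (\<lambda>_. 0) + of_nat 2 * (of_int (2 * E\<^sup>2) * ?Y ^ 2)"
    by (simp add: residue_poly_def E power2_eq_square)
  ultimately have "cyclic_cong m (residue_poly m ?b + of_nat 2 * z')
      (residue_poly m (\<lambda>_. 0) + of_nat 2 * (of_int (2 * E\<^sup>2) * ?Y ^ 2))"
    using cyclic_cong_trans[OF cyclic_cong_sym[OF z']] by simp
  from residue_poly_cong_mod[OF m0 this]
  obtain c where c: "\<forall>i<m. even (?b (int i) - 0 - c)" by auto
  have "even (?b g - c)" for g
    using forall_residues[OF m0 periodic_push_forward, of "\<lambda>x. even (x - c)" 2 "push_forward m 2 a" g] c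
    by simp
  from this[of "int 2 * (int 2 * g)" for g] have "even (a g - c)" for g
    unfolding push_forward_coprime[OF m0 periodic_push_forward cop] push_forward_coprime[OF m0 assms(2) cop] .
  then show ?thesis by blast
qed

text \<open>If the common parity were odd, all values off 0 would be 1, the excluded constant case.
  So \<open>a\<close> is twice a function, and 8 cancels from the equation.\<close>

lemma cubic_even:
  assumes "odd m" "periodic m a" "small_off_0 m a" "cubic m D a" "even D"
    and "\<nexists>c. \<forall>g. \<not> int m dvd g \<longrightarrow> a g = c"
  shows "\<exists>z. (\<forall>g. a g = 2 * z g) \<and> periodic m z \<and> cubic m (D div 2) z"
proof -
  have m0: "m > 0" using assms(1) by (rule odd_pos)
  obtain c where c: "\<And>g. even (a g - c)"
    using cubic_even_imp_parity_const[OF assms(1,2,4,5)] by blast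
  have "even c"
  proof (rule ccontr)
    assume "odd c"
    have "a g = 1" if "\<not> int m dvd g" for g
    proof -
      have "a g \<in> {0..2}" using that assms(3) by (simp add: small_off_0_def)
      moreover have "odd (a g)" using c[of g] \<open>odd c\<close> by simp
      ultimately show ?thesis by (auto elim!: oddE)
    qed
    then show False using assms(6) by blast
  qed
  then have ev: "even (a g)" for g using c[of g] by simp
  define z where "z g = a g div 2" for g
  have az: "a g = 2 * z g" for g using ev by (simp add: z_def)
  have "periodic m z" using assms(2) by (simp add: periodic_def z_def)
  moreover have "cubic m (D div 2) z"
  proof -
    let ?Z = "residue_poly m z"
    have Y: "residue_poly m a = of_int 2 * ?Z"
      unfolding residue_poly_of_int_mult by (rule residue_poly_cong) (rule az)
    obtain E where E: "D = 2 * E" using assms(5) by blast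
    have "cyclic_cong m (of_int 8 * ?Z ^ 3) (of_int 8 * (of_int (E\<^sup>2) * ?Z))"
      using assms(4) unfolding cubic_def Y by (simp add: E power_mult_distrib mult.assoc)
    from cyclic_cong_cancel[OF m0 _ this] show ?thesis by (simp add: cubic_def E)
  qed
  ultimately show ?thesis using az by blast
qed

section \<open>Convolutions and the case \<open>D = 1\<close>\<close>

lemma sum_residues_affine:
  fixes F :: "int \<Rightarrow> int"
  assumes "m > 0" "periodic m F" "\<epsilon> = 1 \<or> \<epsilon> = -1"
  shows "(\<Sum>i<m. F (s + \<epsilon> * int i)) = (\<Sum>i<m. F (int i))"
proof (rule sum.reindex_bij_witness[of _ "\<lambda>i. nat ((\<epsilon> * (int i - s)) mod int m)" "\<lambda>i. nat ((s + \<epsilon> * int i) mod int m)"], goal_cases)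
  have ee: "\<epsilon> * \<epsilon> = 1" using assms(3) by auto
  case (1 i)
  have "(\<epsilon> * ((s + \<epsilon> * int i) mod int m - s)) mod int m = (\<epsilon> * ((s + \<epsilon> * int i) - s)) mod int m"
    by (intro mod_mult_cong mod_diff_cong) simp_all
  also have "\<epsilon> * ((s + \<epsilon> * int i) - s) = (\<epsilon> * \<epsilon>) * int i" by simp
  finally show ?case using 1 assms(1) ee by simp
next
  have ee: "\<epsilon> * \<epsilon> = 1" using assms(3) by auto
  case (3 i)
  have "(s + \<epsilon> * ((\<epsilon> * (int i - s)) mod int m)) mod int m = (s + \<epsilon> * (\<epsilon> * (int i - s))) mod int m"
    by (intro mod_add_cong mod_mult_cong) simp_all
  also have "s + \<epsilon> * (\<epsilon> * (int i - s)) = s + (\<epsilon> * \<epsilon>) * (int i - s)" by simp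
  finally show ?case using 3 assms(1) ee by simp
next
  case (5 i)
  then show ?case using assms(1,2) by (simp add: periodic_mod)
qed (use assms(1) in \<open>auto simp: nat_less_iff\<close>)

lemma periodic_convolution:
  assumes "periodic m b"
  shows "periodic m (convolution m a b)"
  unfolding periodic_def convolution_def
proof (intro allI sum.cong refl arg_cong2[of _ _ _ _ "(*)"])
  show "b (g mod int m - int i) = b (g - int i)" for g i
    by (rule periodic_cong[OF assms]) (rule mod_diff_left_eq)
qed

lemma sum_convolution:
  assumes "m > 0" "periodic m b"
  shows "(\<Sum>g<m. convolution m a b (int g)) = (\<Sum>i<m. a (int i)) * (\<Sum>i<m. b (int i))"
proof -
  have "(\<Sum>g<m. convolution m a b (int g)) = (\<Sum>i<m. \<Sum>g<m. a (int i) * b (- int i + 1 * int g))"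
    unfolding convolution_def by (subst sum.swap) simp
  also have "\<dots> = (\<Sum>i<m. a (int i) * (\<Sum>g<m. b (int g)))"
    unfolding sum_distrib_left[symmetric] by (simp only: sum_residues_affine[OF assms] simp_thms)
  finally show ?thesis by (simp add: sum_distrib_right)
qed

lemma sum_diff_squares:
  fixes x :: "'b \<Rightarrow> int"
  shows "(\<Sum>i\<in>A. \<Sum>j\<in>A. (x i - x j)\<^sup>2) = 2 * (int (card A) * (\<Sum>i\<in>A. (x i)\<^sup>2) - (\<Sum>i\<in>A. x i)\<^sup>2)"
proof -
  have "(\<Sum>i\<in>A. \<Sum>j\<in>A. (x i - x j)\<^sup>2) =
      (\<Sum>i\<in>A. \<Sum>j\<in>A. (x i)\<^sup>2) + (\<Sum>i\<in>A. \<Sum>j\<in>A. (x j)\<^sup>2) - 2 * (\<Sum>i\<in>A. \<Sum>j\<in>A. x i * x j)"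
    by (simp add: power2_diff sum.distrib sum_subtractf sum_distrib_left mult.assoc)
  also have "(\<Sum>i\<in>A. \<Sum>j\<in>A. x i * x j) = (\<Sum>i\<in>A. x i)\<^sup>2"
    by (simp add: power2_eq_square sum_product)
  finally show ?thesis by (simp add: sum_distrib_left)
qed

text \<open>The convolution square of \<open>a\<close> is, up to a constant, a symmetric idempotent, so its value at \<open>0\<close>
  is at most the trace of a projection of rank \<open>m - 1\<close> divided by \<open>m\<close>.\<close>

lemma cubic_1_variance:
  assumes "m > 1" "periodic m a" "\<And>g. a (- g) = a g" "cubic m 1 a"
  shows "int m * (\<Sum>i<m. (a (int i))\<^sup>2) - (\<Sum>i<m. a (int i))\<^sup>2 \<le> int m - 1"
proof -
  have m0: "m > 0" using assms(1) by simp
  define e where "e = convolution m a a"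
  define s where "s = (\<Sum>i<m. a (int i))"
  have pe: "periodic m e" unfolding e_def by (rule periodic_convolution[OF assms(2)])
  let ?Y = "residue_poly m a" and ?E = "residue_poly m e"
  have YE: "cyclic_cong m (?Y * ?Y) ?E"
    unfolding e_def by (rule cyclic_cong_residue_poly_mult[OF m0 assms(2)])
  have "cyclic_cong m (residue_poly m (convolution m e e)) (?E * ?E)"
    by (rule cyclic_cong_sym[OF cyclic_cong_residue_poly_mult[OF m0 pe]])
  also have "cyclic_cong m (?E * ?E) ((?Y * ?Y) * (?Y * ?Y))"
    by (intro cyclic_cong_mult cyclic_cong_sym[OF YE])
  also have "(?Y * ?Y) * (?Y * ?Y) = ?Y * ?Y ^ 3" by (simp add: power3_eq_cube)
  also have "cyclic_cong m (?Y * ?Y ^ 3) (?Y * ?Y)"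
    using assms(4) by (intro cyclic_cong_mult cyclic_cong_refl) (simp add: cubic_def)
  also note YE
  finally have "cyclic_cong m (residue_poly m (\<lambda>g. convolution m e e g - e g)) 0"
    unfolding residue_poly_diff[symmetric] by (simp add: cyclic_cong_def)
  from cyclic_cong_residue_poly_0_imp_const[OF m0 this]
  obtain c where c: "\<And>i. i < m \<Longrightarrow> convolution m e e (int i) = e (int i) + c"
    by (metis add.commute diff_add_cancel)
  have e_sym: "e (- g) = e g" for g
  proof -
    have "e (- g) = (\<Sum>i<m. a (int i) * a (g + int i))"
      unfolding e_def convolution_def
    proof (intro sum.cong refl arg_cong2[of _ _ _ _ "(*)"])
      show "a (- g - int i) = a (g + int i)" for i using assms(3)[of "g + int i"] by simp
    qed
    also have "\<dots> = (\<Sum>i<m. a (- g + 1 * int i) * a (g + (- g + 1 * int i)))"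
    proof (rule sum_residues_affine[OF m0, symmetric, where F = "\<lambda>i. a i * a (g + i)"])
      have "a (g + h mod int m) = a (g + h)" for h
        by (rule periodic_cong[OF assms(2)]) (rule mod_add_right_eq)
      then show "periodic m (\<lambda>i. a i * a (g + i))"
        using periodic_mod[OF assms(2)] by (simp add: periodic_def)
    qed simp
    also have "\<dots> = (\<Sum>i<m. a (int i) * a (g - int i))"
    proof (intro sum.cong refl)
      show "a (- g + 1 * int i) * a (g + (- g + 1 * int i)) = a (int i) * a (g - int i)" for i
        using assms(3)[of "g - int i"] by (simp add: mult.commute)
    qed
    finally show ?thesis by (simp add: e_def convolution_def)
  qed
  have e0: "e 0 = (\<Sum>i<m. (a (int i))\<^sup>2)"
    unfolding e_def convolution_def using assms(3) by (simp add: power2_eq_square)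
  have se: "(\<Sum>i<m. e (int i)) = s\<^sup>2"
    unfolding e_def sum_convolution[OF m0 assms(2)] by (simp add: s_def power2_eq_square)
  have ee: "(\<Sum>i<m. (e (int i))\<^sup>2) = e 0 + c"
    using c[of 0] m0 e_sym by (simp add: convolution_def power2_eq_square)
  have "s ^ 4 = s\<^sup>2 + int m * c"
  proof -
    have "(\<Sum>g<m. convolution m e e (int g)) = s\<^sup>2 * s\<^sup>2" unfolding sum_convolution[OF m0 pe] se ..
    moreover have "(\<Sum>g<m. convolution m e e (int g)) = (\<Sum>g<m. e (int g) + c)"
      by (intro sum.cong refl c) simp
    ultimately show ?thesis by (simp add: sum.distrib se flip: power_add)
  qed
  then have mc: "int m * c = s ^ 4 - s\<^sup>2" by simp
  \<comment> \<open>The nonnegative sum of squared differences of \<open>e\<close> over the nonzero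
    residues turns into \<open>X * X \<le> (m - 1) * X\<close>.\<close>
  define R where "R = {1..<m}"
  have split: "{..<m} = insert 0 R" "0 \<notin> R" "finite R" "int (card R) = int m - 1"
    using assms(1) by (auto simp: R_def)
  have "0 \<le> 2 * (int (card R) * (\<Sum>i\<in>R. (e (int i))\<^sup>2) - (\<Sum>i\<in>R. e (int i))\<^sup>2)"
    unfolding sum_diff_squares[symmetric] by (intro sum_nonneg) simp
  moreover have "(\<Sum>i\<in>R. (e (int i))\<^sup>2) = e 0 + c - (e 0)\<^sup>2" using ee split by simp
  moreover have "(\<Sum>i\<in>R. e (int i)) = s\<^sup>2 - e 0" using se split by simp
  ultimately have ineq: "(s\<^sup>2 - e 0)\<^sup>2 \<le> (int m - 1) * (e 0 + c - (e 0)\<^sup>2)" using split(4) by simp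
  define X where "X = int m * e 0 - s\<^sup>2"
  have "int m * (s\<^sup>2 - e 0)\<^sup>2 \<le> int m * ((int m - 1) * (e 0 + c - (e 0)\<^sup>2))"
    using ineq by (intro mult_left_mono) auto
  also have "\<dots> = (int m - 1) * (int m * e 0 + int m * c - int m * (e 0)\<^sup>2)" by (simp add: algebra_simps)
  finally have "X * X \<le> (int m - 1) * X"
    unfolding mc X_def by (simp add: algebra_simps power2_eq_square power4_eq_xxxx)
  then have "X \<le> int m - 1"
    using assms(1) by (cases "X > 0") auto
  then show ?thesis by (simp add: X_def e0 s_def)
qed

text \<open>If \<open>a g\<close> and \<open>a h\<close> differ off 0, then \<open>g\<close>,
  \<open>- g\<close>, \<open>h\<close>, \<open>- h\<close> are four distinct residues, as
  \<open>m\<close> is odd and \<open>a\<close> is even, and any given value differs from the values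
  at two of them or more. Over ordered pairs the squared differences sum to at least
  \<open>4 * m - 8\<close>, while the variance bound allows only \<open>2 * (m - 1)\<close>.\<close>

lemma cubic_1_imp_const:
  assumes "odd m" "periodic m a" "\<And>g. a (- g) = a g" "cubic m 1 a"
  shows "\<exists>c. \<forall>g. \<not> int m dvd g \<longrightarrow> a g = c"
proof (rule ccontr)
  assume non: "\<nexists>c. \<forall>g. \<not> int m dvd g \<longrightarrow> a g = c"
  have m0: "m > 0" using assms(1) by (rule odd_pos)
  obtain g where g: "\<not> int m dvd g" using non by blast
  obtain h where h: "\<not> int m dvd h" "a h \<noteq> a g" using non by blast
  define res where "res x = nat (x mod int m)" for x
  have res: "res x < m" "int (res x) = x mod int m" "a (int (res x)) = a x" for x
    using m0 periodic_mod[OF assms(2)] by (auto simp: res_def nat_less_iff)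
  have res_eq: "res x = res y \<longleftrightarrow> int m dvd x - y" for x y
    using res(2) by (metis mod_eq_dvd_iff of_nat_eq_iff)
  have opp: "res x \<noteq> res (- x)" if "\<not> int m dvd x" for x
  proof
    assume "res x = res (- x)"
    then have "int m dvd 2 * x" using res_eq[of x "- x"] by simp
    moreover have "coprime (int m) 2" using assms(1) by simp
    ultimately show False using that by (simp add: coprime_dvd_mult_right_iff)
  qed
  define Q where "Q = {res g, res (- g), res h, res (- h)}"
  have av: "a (int (res (- g))) = a g" "a (int (res (- h))) = a h" by (simp_all add: res(3) assms(3))
  have dist: "res g \<noteq> res h" "res g \<noteq> res (- h)" "res (- g) \<noteq> res h" "res (- g) \<noteq> res (- h)"
    using h(2) av res(3) by metis+
  have fQ: "finite Q" "Q \<subseteq> {..<m}" using res(1) by (auto simp: Q_def)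
  have sumQ: "(\<Sum>i\<in>Q. f i) = f (res g) + f (res (- g)) + f (res h) + f (res (- h))" for f :: "nat \<Rightarrow> int"
    using dist opp[OF g] opp[OF h(1)] by (simp add: Q_def)
  have cQ: "card Q = 4" using dist opp[OF g] opp[OF h(1)] by (simp add: Q_def)
  define d where "d i j = (a (int i) - a (int j))\<^sup>2" for i j
  have "m \<ge> 4" using card_mono[OF _ fQ(2)] cQ by simp
  moreover have "m \<noteq> 4" using assms(1) by auto
  ultimately have m5: "m \<ge> 5" by simp
  have two: "(\<Sum>i\<in>Q. d i j) \<ge> 2" for j
  proof -
    define q where "q = (a g - a (int j))\<^sup>2 + (a h - a (int j))\<^sup>2"
    have "(\<Sum>i\<in>Q. d i j) = 2 * q"
      by (simp add: sumQ d_def res(3) assms(3) q_def)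
    moreover have "0 < q"
      using h(2) by (auto simp: sum_power2_gt_zero_iff q_def)
    ultimately show ?thesis by simp
  qed
  have nn: "d i j \<ge> 0" for i j by (simp add: d_def)
  let ?R = "{..<m} - Q"
  have cR: "int (card ?R) = int m - 4" using card_Diff_subset[OF fQ] cQ \<open>m \<ge> 4\<close> by simp
  have ds: "d i j = d j i" for i j by (simp add: d_def power2_commute)
  have "2 * int m + 2 * (int m - 4) \<le> (\<Sum>i<m. \<Sum>j<m. d i j)"
  proof -
    have "(\<Sum>i<m. \<Sum>j<m. d i j) = (\<Sum>i\<in>Q. \<Sum>j<m. d i j) + (\<Sum>i\<in>?R. \<Sum>j<m. d i j)"
      using fQ by (simp add: sum.subset_diff[of Q "{..<m}"])
    moreover have "(\<Sum>i\<in>Q. \<Sum>j<m. d i j) = (\<Sum>j<m. \<Sum>i\<in>Q. d i j)" by (rule sum.swap)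
    moreover have "(\<Sum>j<m. \<Sum>i\<in>Q. d i j) \<ge> (\<Sum>j<m. 2)" by (intro sum_mono two)
    moreover have "(\<Sum>i\<in>?R. \<Sum>j<m. d i j) \<ge> (\<Sum>i\<in>?R. 2)"
    proof (rule sum_mono)
      fix i
      have "2 \<le> (\<Sum>j\<in>Q. d i j)" using two[of i] by (simp add: ds[of _ i])
      also have "\<dots> \<le> (\<Sum>j<m. d i j)" using fQ nn by (intro sum_mono2) auto
      finally show "2 \<le> (\<Sum>j<m. d i j)" .
    qed
    ultimately show ?thesis using cR by simp
  qed
  also have "\<dots> = 2 * (int m * (\<Sum>i<m. (a (int i))\<^sup>2) - (\<Sum>i<m. a (int i))\<^sup>2)"
    using sum_diff_squares[of "\<lambda>i. a (int i)" "{..<m}"] by (simp add: d_def)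
  also have "\<dots> \<le> 2 * (int m - 1)"
    using cubic_1_variance[OF _ assms(2,3,4)] m5 by simp
  finally show False using m5 by simp
qed

section \<open>Classification of the functions satisfying the cubic equation\<close>

text \<open>Constants vanish modulo \<open>cyclic_sum m\<close>, so the polynomial reduces to the
  number \<open>a 0 - c\<close>, which then satisfies the cubic equation itself.\<close>

lemma cubic_const_off_0:
  assumes "m > 1" "periodic m a" "cubic m D a" "\<And>g. \<not> int m dvd g \<Longrightarrow> a g = c"
  shows "a 0 = c \<or> \<bar>a 0 - c\<bar> = \<bar>D\<bar>"
proof -
  have m0: "m > 0" using assms(1) by simp
  define \<beta> where "\<beta> = a 0 - c"
  let ?Y = "residue_poly m a"
  have "?Y = residue_poly m (\<lambda>g. c + \<beta> * of_bool (int m dvd g))"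
    by (rule residue_poly_cong) (auto simp: \<beta>_def assms(4) dest: periodic_dvd[OF assms(2)])
  then have "?Y = residue_poly m (\<lambda>_. c) + of_int \<beta>"
    unfolding residue_poly_add[symmetric] using residue_poly_delta[OF m0] by simp
  moreover have "cyclic_cong m (residue_poly m (\<lambda>_. c) + of_int \<beta>) (0 + of_int \<beta>)"
    by (intro cyclic_cong_add cyclic_cong_residue_poly_const cyclic_cong_refl)
  ultimately have Y: "cyclic_cong m ?Y (of_int \<beta>)" by simp
  have "cyclic_cong m (of_int \<beta> ^ 3) (?Y ^ 3)" by (rule cyclic_cong_sym[OF cyclic_cong_power[OF Y]])
  also have "cyclic_cong m \<dots> (of_int (D\<^sup>2) * ?Y)" using assms(3) by (simp add: cubic_def)
  also have "cyclic_cong m \<dots> (of_int (D\<^sup>2) * of_int \<beta>)" by (rule cyclic_cong_mult[OF cyclic_cong_refl Y])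
  finally have "cyclic_cong m (of_int (\<beta> ^ 3 - D\<^sup>2 * \<beta>)) 0" by (simp add: cyclic_cong_def)
  then have "cyclic_cong m (residue_poly m (\<lambda>g. (\<beta> ^ 3 - D\<^sup>2 * \<beta>) * of_bool (int m dvd g))) 0"
    unfolding residue_poly_delta[OF m0] .
  from cyclic_cong_residue_poly_0_imp_const[OF m0 this]
  obtain k where k: "\<And>i. i < m \<Longrightarrow> (\<beta> ^ 3 - D\<^sup>2 * \<beta>) * of_bool (int m dvd int i) = k" by blast
  have "\<beta> ^ 3 - D\<^sup>2 * \<beta> = 0" using k[of 0] k[of 1] assms(1) by simp
  then have "\<beta> * (\<beta>\<^sup>2 - D\<^sup>2) = 0" by (simp add: power2_eq_square power3_eq_cube algebra_simps)
  then show ?thesis by (auto simp: power2_eq_iff \<beta>_def)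
qed

text \<open>Strong induction on \<open>m\<close>. Unless \<open>a\<close> is constant off 0, an odd
  prime dividing \<open>D\<close> divides \<open>m\<close> too, and both are divided by it. Without
  such a prime \<open>D\<close> is a power of 2, and the prime 2 together with the case
  \<open>D = 1\<close> gives constancy off 0.\<close>

theorem cubic_classification:
  assumes "odd m" "periodic m a" "\<And>g. a (- g) = a g" "small_off_0 m a" "cubic m D a" "D > 0"
    and "a 0 \<in> {0..2} \<or> (\<forall>j\<in>{0..2}. \<bar>a 0 - j\<bar> \<noteq> D)"
  shows "\<exists>d c. d dvd m \<and> (\<forall>g. a g = (if int d dvd g then a 0 else c)) \<and>
           (a 0 = c \<or> D = \<bar>a 0 - c\<bar> * int (m div d))"
  using assms
proof (induction m arbitrary: D rule: less_induct)
  case (less m)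
  note odd = less.prems(1) and per = less.prems(2) and sym = less.prems(3) and small = less.prems(4)
    and cub = less.prems(5) and D = less.prems(6) and H = less.prems(7)
  have m0: "m > 0" using odd by (rule odd_pos)
  show ?case
  proof (cases "\<exists>c. \<forall>g. \<not> int m dvd g \<longrightarrow> a g = c")
    case True
    then obtain c where c: "\<And>g. \<not> int m dvd g \<Longrightarrow> a g = c" by blast
    show ?thesis
    proof (cases "m = 1")
      case True
      show ?thesis
      proof (intro exI[of _ "1::nat"] exI[of _ "a 0"] conjI allI)
        show "a g = (if int 1 dvd g then a 0 else a 0)" for g
          using periodic_dvd[OF per, of g] True by simp
      qed simp_all
    next
      case False
      then have or: "a 0 = c \<or> \<bar>a 0 - c\<bar> = \<bar>D\<bar>"
        using m0 by (intro cubic_const_off_0[OF _ per cub c]) auto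
      show ?thesis
      proof (intro exI[of _ m] exI[of _ c] conjI allI)
        show "a g = (if int m dvd g then a 0 else c)" for g
          using c[of g] periodic_dvd[OF per, of g] by simp
        show "a 0 = c \<or> D = \<bar>a 0 - c\<bar> * int (m div m)" using or D m0 by auto
      qed simp
    qed
  next
    case False
    note nonconst = this
    have no: "\<not> (prime p \<and> odd p \<and> int p dvd D \<and> \<not> p dvd m)" for p
      using odd_prime_dvd_imp_const[OF m0 per small cub] nonconst by blast
    show ?thesis
    proof (cases "\<exists>p::nat. prime p \<and> odd p \<and> int p dvd D")
      case True
      then obtain p :: nat where p: "prime p" "odd p" "int p dvd D" by blast
      then have "p dvd m" using no by blast
      then obtain M where M: "m = p * M" by blast
      obtain E where E: "D = int p * E" using p(3) by blast
      have M0: "M > 0" and p0: "p > 1" using m0 M p(1) prime_gt_1_nat by auto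
      then have Mm: "M < m" using M by simp
      have perM: "periodic M a"
        using periodic_descent[OF m0 per small cub _ p(1,2) M p(3)] D H by auto
      \<comment> \<open>Period \<open>M\<close> carries the small value at \<open>M\<close> over to
        0, so from here on the last hypothesis holds by its first alternative.\<close>
      have "\<not> int m dvd int M" using Mm M0 by (auto dest: zdvd_imp_le)
      then have "a (int M) \<in> {0..2}" using small by (simp add: small_off_0_def)
      then have a0: "a 0 \<in> {0..2}" using periodic_dvd[OF perM, of "int M"] by simp
      have smM: "small_off_0 M a"
        unfolding small_off_0_def
      proof (intro allI impI)
        fix g
        show "a g \<in> {0..2}"
          using a0 small periodic_dvd[OF per, of g] by (cases "int m dvd g") (auto simp: small_off_0_def)
      qed
      have E0: "E > 0" using D E p0 by (simp add: zero_less_mult_iff)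
      have oM: "odd M" using odd M by simp
      have cM: "cubic M E a" using cubic_descent[OF M0 _ perM, of p E] cub M E p0 by simp
      obtain d c where dc: "d dvd M" "\<forall>g. a g = (if int d dvd g then a 0 else c)"
        "a 0 = c \<or> E = \<bar>a 0 - c\<bar> * int (M div d)"
        using less.IH[OF Mm oM perM sym smM cM E0 disjI1[OF a0]] by blast
      have "d dvd m" using dc(1) M by simp
      moreover have "int (m div d) = int p * int (M div d)"
        using dc(1) by (simp add: M div_mult_swap[symmetric] flip: of_nat_mult)
      ultimately have "d dvd m" "a 0 = c \<or> D = \<bar>a 0 - c\<bar> * int (m div d)" using dc(3) E by auto
      with dc(2) show ?thesis by blast
    next
      case False
      have pow2: "x = 1" if x: "odd x" "x dvd D" "x > 0" for x :: int
      proof (rule ccontr)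
        assume "x \<noteq> 1"
        then have "nat x \<noteq> 1" using x(3) by simp
        then obtain p where p: "prime p" "p dvd nat x" using prime_factor_nat by blast
        have "int p dvd int (nat x)" using p(2) by (simp only: of_nat_dvd_iff)
        then have px: "int p dvd x" using x(3) by simp
        then have "odd p" using x(1) dvd_trans[of 2 "int p" x] by auto
        moreover have "int p dvd D" using px x(2) by (rule dvd_trans)
        ultimately show False using False p(1) by blast
      qed
      have "\<exists>c. \<forall>g. \<not> int m dvd g \<longrightarrow> a g = c"
      proof (cases "even D")
        case True
        obtain z where z: "\<And>g. a g = 2 * z g" "periodic m z" "cubic m (D div 2) z"
          using cubic_even[OF odd per small cub True nonconst] by blast
        \<comment> \<open>Off 0 the halved function takes only the values 0 and 1. If 4 divides
          \<open>D\<close>, parity makes them equal; otherwise \<open>D div 2\<close> is 1.\<close>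
        have "\<exists>c. \<forall>g. \<not> int m dvd g \<longrightarrow> z g = c"
        proof (cases "even (D div 2)")
          case True
          obtain c where c: "\<And>g. even (z g - c)"
            using cubic_even_imp_parity_const[OF odd z(2,3) True] by blast
          have "z g = c mod 2" if "\<not> int m dvd g" for g
          proof -
            have "a g \<in> {0..2}" using small that by (simp add: small_off_0_def)
            then have "2 * z g \<in> {0..2}" by (simp only: z(1))
            then have "z g = 0 \<or> z g = 1" by auto
            then show ?thesis using c[of g] by presburger
          qed
          then show ?thesis by blast
        next
          case False
          then have "D div 2 = 1" using \<open>even D\<close> D by (intro pow2) auto
          then show ?thesis using cubic_1_imp_const[OF odd z(2)] z(1,3) sym by simp
        qed
        then show ?thesis using z(1) by auto
      next
        case False
        then have "D = 1" using D by (intro pow2) auto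
        then show ?thesis using cubic_1_imp_const[OF odd per sym] cub by simp
      qed
      then show ?thesis using nonconst by blast
    qed
  qed
qed

section \<open>Parameters of strongly regular bicirculants\<close>

text \<open>If \<open>a = c\<close>, only \<open>c = 1\<close> survives, and
  \<open>s = r - t\<close> parametrizes the family. Otherwise \<open>D = |a - c| * h\<close>; parity
  leaves \<open>c = 0\<close> and its complementary case \<open>c = 2\<close>, which yield the
  Hoffman--Singleton parameters and those of the complement.\<close>

lemma parameter_classification:
  fixes n k l mu r t c d h a D :: int
  assumes n: "n > 1" "odd n" and h: "n = d * h" "h > 0"
    and k: "k = r + t" and mu: "mu > 0" and mu': "2 * n - 2 * k + l > 0"
    and rho: "(r - t)\<^sup>2 = (l - mu) * (r - t) + (k - mu)"
    and rt: "2 * r * t = (l - mu) * t + n * mu"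
    and D: "D > 0" "D\<^sup>2 = (l - mu)\<^sup>2 + 4 * (k - mu)"
    and a: "a = mu - l" "a \<in> {0..2}" "c \<in> {0..2}"
    and r: "2 * r + a = c * (n - h) + a * h"
    and or: "a = c \<or> D = \<bar>a - c\<bar> * h"
  shows "(\<exists>s. n = 2 * s\<^sup>2 + 2 * s + 1 \<and> k = s * (2 * s + 1) \<and> l = s\<^sup>2 - 1 \<and> mu = s\<^sup>2) \<or>
         (n = 25 \<and> k = 7 \<and> l = 0 \<and> mu = 1) \<or> (n = 25 \<and> k = 42 \<and> l = 35 \<and> mu = 36)"
proof -
  have l: "l = mu - a" using a by simp
  have oh: "odd h" using n h by auto
  show ?thesis
  proof (cases "a = c")
    case True
    then have 2: "2 * r = c * (n - 1)" using r by (simp add: algebra_simps)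
    consider "c = 0" | "c = 1" | "c = 2" using a(3) by force
    then show ?thesis
    proof cases
      case 1
      then show ?thesis using 2 rt True l n mu by simp
    next
      case 2: 2
      then have r2: "n = 2 * r + 1" using \<open>2 * r = c * (n - 1)\<close> by simp
      have "n * t = n * mu" using rt True 2 l by (simp add: r2 algebra_simps)
      then have t: "t = mu" using n by simp
      define s where "s = r - t"
      have "r = s\<^sup>2 + s" using rho True 2 l k t by (simp add: s_def)
      moreover have "t = s\<^sup>2" using \<open>r = s\<^sup>2 + s\<close> by (simp add: s_def)
      ultimately have "n = 2 * s\<^sup>2 + 2 * s + 1 \<and> k = s * (2 * s + 1) \<and> l = s\<^sup>2 - 1 \<and> mu = s\<^sup>2"
        using r2 k t l True 2 by (simp add: algebra_simps power2_eq_square)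
      then show ?thesis by blast
    next
      case 3
      then have r2: "r = n - 1" using 2 by simp
      have "n * (2 * t) = n * mu" using rt True 3 l by (simp add: r2 algebra_simps)
      then have "mu = 2 * t" using n by simp
      then show ?thesis using mu' k r2 l True 3 by simp
    qed
  next
    case False
    then have Dh: "D = \<bar>a - c\<bar> * h" using or by simp
    \<comment> \<open>\<open>D^2 - a^2\<close> is a multiple of 4; as \<open>h\<close> is odd,
      \<open>D\<close> has the parity of \<open>a - c\<close>, so \<open>c\<close> must be
      even.\<close>
    have "even (D - a)"
    proof -
      have "even (D\<^sup>2 - a\<^sup>2)" using D(2) l by simp
      then show ?thesis by simp
    qed
    then have "even c" using Dh oh by (auto simp: abs_if split: if_splits)
    then have c: "c = 0 \<or> c = 2" using a(3) by (auto elim!: evenE)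
    have "(2 * (r - t) + a)\<^sup>2 = ((a - c) * h)\<^sup>2"
    proof -
      have "(2 * (r - t) + a)\<^sup>2 = 4 * ((r - t)\<^sup>2 + a * (r - t)) + a\<^sup>2" by (simp add: power2_eq_square algebra_simps)
      also have "\<dots> = D\<^sup>2" using rho D(2) l by simp
      also have "\<dots> = ((a - c) * h)\<^sup>2" by (simp add: Dh power_mult_distrib)
      finally show ?thesis .
    qed
    then have "2 * (r - t) + a = (a - c) * h \<or> 2 * (r - t) + a = - ((a - c) * h)"
      by (simp add: power2_eq_iff)
    then have t: "2 * t = c * n \<or> 2 * t = c * n + 2 * ((a - c) * h)"
      using r by (auto simp: algebra_simps)
    have D4: "((a - c) * h)\<^sup>2 = a\<^sup>2 + 4 * (k - mu)" using D(2) Dh l by (simp add: power_mult_distrib)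
    \<comment> \<open>This serves \<open>|a - c| = 2\<close>, and \<open>one\<close> serves
      \<open>|a - c| = 1\<close>; \<open>x\<close> will be \<open>mu\<close> or its counterpart in
      the complement. Positivity of \<open>x\<close> bounds the odd number \<open>h\<close>.\<close>
    have two: False if "4 * h\<^sup>2 = n * x" "h\<^sup>2 = 3 * h - x" "x > 0" for x
    proof -
      have "h * (3 - h) > 0" using that by (simp add: power2_eq_square algebra_simps)
      then have "h < 3" using h(2) by (simp add: zero_less_mult_iff)
      then have "h = 1" using h(2) oh by presburger
      then show False using that n(2) by auto
    qed
    have one: "h = 5 \<and> x = 1 \<and> n = 25" if "h\<^sup>2 = n * x" "h\<^sup>2 = 6 * h - 1 - 4 * x" "x > 0" for x
    proof -
      have "h * (6 - h) > 0" using that by (simp add: power2_eq_square algebra_simps)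
      then have "h < 6" using h(2) by (simp add: zero_less_mult_iff)
      then have "h = 1 \<or> h = 3 \<or> h = 5" using h(2) oh by presburger
      then show ?thesis
      proof (elim disjE)
        assume "h = 1"
        then show ?thesis using that n by auto
      next
        assume "h = 3"
        then have "n * 2 = 9" using that by auto
        then show ?thesis by presburger
      next
        assume "h = 5"
        then show ?thesis using that by auto
      qed
    qed
    have rt': "(2 * r + a) * t = n * mu" using rt l by (simp add: algebra_simps)
    have mu'': "2 * n - 2 * k + mu - a > 0" using mu' l by simp
    from c show ?thesis
    proof
      assume c0: "c = 0"
      have "t \<noteq> 0" using rt' n mu by auto
      then have t: "t = a * h" using t c0 by simp
      have ra: "2 * r + a = a * h" using r c0 by simp
      have sq: "a\<^sup>2 * h\<^sup>2 = n * mu" using rt' unfolding ra t by (simp add: power2_eq_square algebra_simps)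
      have D': "a\<^sup>2 * h\<^sup>2 = a\<^sup>2 - 2 * a + 6 * (a * h) - 4 * mu"
        using D4 ra t k c0 by (simp add: power_mult_distrib)
      have "a = 1 \<or> a = 2" using a(2) False c0 by force
      then show ?thesis
      proof
        assume "a = 1"
        moreover from this have "h = 5 \<and> mu = 1 \<and> n = 25" using sq D' mu by (intro one) auto
        ultimately show ?thesis using t ra k l by simp
      next
        assume "a = 2"
        then show ?thesis using two[OF _ _ mu] sq D' by simp
      qed
    next
      assume c2: "c = 2"
      \<comment> \<open>\<open>b\<close> and \<open>x\<close> are what \<open>a\<close> and
        \<open>mu\<close> become for the complement, so the equations of the case
        \<open>c = 0\<close> reappear.\<close>
      define b where "b = 2 - a"
      define x where "x = 2 * n - 2 * k + mu - a"
      have x0: "x > 0" using mu'' by (simp add: x_def)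
      have "t \<noteq> n"
      proof
        assume "t = n"
        then have "mu = 2 * r + a" using rt' n by (simp add: mult.commute)
        then show False using mu'' \<open>t = n\<close> k by simp
      qed
      then have t: "t = n - b * h" using t c2 by (simp add: b_def algebra_simps)
      have ra: "2 * r + a = 2 * n - b * h" using r c2 by (simp add: b_def algebra_simps)
      have m: "mu = x + 2 * n - 3 * (b * h)" using ra t k by (simp add: x_def)
      have sq: "b\<^sup>2 * h\<^sup>2 = n * x"
        using rt' unfolding ra t m by (simp add: power2_eq_square algebra_simps)
      have "(a - c)\<^sup>2 = b\<^sup>2" using c2 by (simp add: b_def power2_commute)
      then have D': "b\<^sup>2 * h\<^sup>2 = a\<^sup>2 - 2 * a + 6 * (b * h) - 4 * x"
        using D4 ra t k m by (simp add: power_mult_distrib)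
      have "a = 1 \<or> a = 0" using a(2) False c2 by force
      then show ?thesis
      proof
        assume a1: "a = 1"
        then have "b = 1" by (simp add: b_def)
        then have "h = 5 \<and> x = 1 \<and> n = 25" using sq D' x0 a1 by (intro one) auto
        then show ?thesis using t ra k l m \<open>b = 1\<close> a1 by simp
      next
        assume "a = 0"
        then have "b = 2" by (simp add: b_def)
        then show ?thesis using two[OF _ _ x0] sq D' \<open>a = 0\<close> by simp
      qed
    qed
  qed
qed

section \<open>From the symbol to the cubic equation and the parameters\<close>

lemma cyclic_cong_convolution_sum:
  assumes "m > 0" "periodic m b" "periodic m b'"
    and "\<And>g. convolution m a b g + convolution m a' b' g = e g + c"
  shows "cyclic_cong m (residue_poly m a * residue_poly m b + residue_poly m a' * residue_poly m b') (residue_poly m e)"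
proof -
  have "cyclic_cong m (residue_poly m a * residue_poly m b + residue_poly m a' * residue_poly m b')
      (residue_poly m (convolution m a b) + residue_poly m (convolution m a' b'))"
    by (intro cyclic_cong_add cyclic_cong_residue_poly_mult assms)
  also have "\<dots> = residue_poly m e + residue_poly m (\<lambda>_. c)"
    unfolding residue_poly_add assms(4) ..
  also have "cyclic_cong m \<dots> (residue_poly m e + 0)"
    by (intro cyclic_cong_add cyclic_cong_refl cyclic_cong_residue_poly_const)
  finally show ?thesis by simp
qed

lemma card_multiples_below:
  assumes "d dvd n" "n > 0"
  shows "card {i. i < n \<and> d dvd i} = n div d"
proof -
  have d0: "d > 0" using assms by (auto intro: Nat.gr0I)
  have "{i. i < n \<and> d dvd i} = (\<lambda>i. d * i) ` {..<n div d}"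
    using assms d0 by (auto simp: dvd_def image_iff)
  moreover have "inj_on (\<lambda>i. d * i) {..<n div d}" using d0 by (auto simp: inj_on_def)
  ultimately show ?thesis by (simp add: card_image)
qed

text \<open>Eliminating \<open>T\<close> and \<open>R - S\<close> from the three path equations by Cayley--Hamilton for the
  \<open>2 \<times> 2\<close> matrix over the group ring with rows \<open>(R, T)\<close> and \<open>(T', S)\<close>.\<close>

lemma cubic_identity:
  fixes R S T T' w q :: "'b :: comm_ring_1"
  shows "(R + S - w) ^ 3 - (w\<^sup>2 + 4 * q) * (R + S - w) =
    2 * (R + S - w) * ((R * R + T * T' - (w * R + q)) + (S * S + T' * T - (w * S + q)))
    - (R - S) * ((R * R + T * T' - (w * R + q)) - (S * S + T' * T - (w * S + q)))
    - 4 * T' * (R * T + T * S - w * T)"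
  by (simp add: algebra_simps power2_eq_square power3_eq_cube)

text \<open>\<open>R\<close>, \<open>S\<close> and \<open>T\<close> are the indicator functions of the symbol of a strongly regular bicirculant: the
  adjacencies inside the first orbit, inside the second orbit and from the first to the second.\<close>

locale bicirculant_symbol =
  fixes n :: nat and R S T :: "int \<Rightarrow> int" and k l mu :: int
  assumes odd_n: "odd n" and n_gt_1: "n > 1"
    and periodic_R: "periodic n R" and periodic_S: "periodic n S" and periodic_T: "periodic n T"
    and R_range: "R g \<in> {0..1}" and S_range: "S g \<in> {0..1}"
    and R_0: "R 0 = 0" and S_0: "S 0 = 0"
    and R_minus: "R (- g) = R g" and S_minus: "S (- g) = S g"
    and degree_R: "(\<Sum>i<n. R (int i)) + (\<Sum>i<n. T (int i)) = k"
    and degree_S: "(\<Sum>i<n. S (int i)) + (\<Sum>i<n. T (int i)) = k"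
    and paths_R: "convolution n R R g + convolution n T (\<lambda>h. T (- h)) g
      = (l - mu) * R g + (k - mu) * of_bool (int n dvd g) + mu"
    and paths_S: "convolution n S S g + convolution n (\<lambda>h. T (- h)) T g
      = (l - mu) * S g + (k - mu) * of_bool (int n dvd g) + mu"
    and paths_T: "convolution n R T g + convolution n T S g = (l - mu) * T g + mu"
    and mu_pos: "mu > 0" and mu_le: "mu \<le> k" and mu'_pos: "2 * int n - 2 * k + l > 0"
begin

definition "w = l - mu"
definition "r = (\<Sum>i<n. R (int i))"
definition "t = (\<Sum>i<n. T (int i))"
text \<open>\<open>r - t\<close> is the eigenvalue of the vector that is 1 on one orbit and -1 on
  the other. The second root of \<open>X^2 - w * X - (k - mu)\<close> is \<open>w - (r - t)\<close>,
  so \<open>D\<close> is the distance of two integer roots.\<close>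

definition "D = \<bar>2 * (r - t) - w\<bar>"
text \<open>The trace of the symbol matrix minus \<open>w\<close>. At a non-principal character both
  eigenvalues are roots of the quadratic, whose two roots add up to \<open>w\<close>; this leaves
  the values 0, \<open>D\<close> and \<open>- D\<close>.\<close>

definition "a g = R g + S g - w * of_bool (int n dvd g)"

lemma n_pos: "n > 0" using n_gt_1 by simp

lemma periodic_T_minus: "periodic n (\<lambda>h. T (- h))"
  unfolding periodic_def
proof
  show "T (- (g mod int n)) = T (- g)" for g
    by (rule periodic_cong[OF periodic_T]) (rule mod_minus_eq)
qed

lemma sum_T_minus: "(\<Sum>i<n. T (- int i)) = t"
  using sum_residues_affine[OF n_pos periodic_T, of "-1" 0] by (simp add: t_def)

lemma sum_S: "(\<Sum>i<n. S (int i)) = r"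
  using degree_R degree_S by (simp add: r_def)

lemma k_eq: "k = r + t" using degree_R by (simp add: r_def t_def)

lemma sum_delta: "(\<Sum>i<n. of_bool (int n dvd int i)) = (1::int)"
proof -
  have "(\<Sum>i<n. of_bool (int n dvd int i)) = (\<Sum>i<n. of_bool (i = 0) :: int)"
    by (intro sum.cong refl arg_cong[of _ _ of_bool]) (auto dest: zdvd_imp_le)
  then show ?thesis using n_pos by simp
qed

lemma sum_paths_R: "r\<^sup>2 + t\<^sup>2 = w * r + (k - mu) + int n * mu"
proof -
  have "(\<Sum>g<n. convolution n R R (int g) + convolution n T (\<lambda>h. T (- h)) (int g))
      = (\<Sum>g<n. w * R (int g) + (k - mu) * of_bool (int n dvd int g) + mu)"
    unfolding paths_R w_def ..
  then show ?thesis
    unfolding sum.distrib sum_convolution[OF n_pos periodic_R] sum_convolution[OF n_pos periodic_T_minus]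
      sum_distrib_left[symmetric] sum_T_minus sum_delta
    by (simp add: power2_eq_square flip: r_def t_def)
qed

lemma sum_paths_T: "2 * r * t = w * t + int n * mu"
proof -
  have "(\<Sum>g<n. convolution n R T (int g) + convolution n T S (int g)) = (\<Sum>g<n. w * T (int g) + mu)"
    unfolding paths_T w_def ..
  then show ?thesis
    unfolding sum.distrib sum_convolution[OF n_pos periodic_S] sum_convolution[OF n_pos periodic_T]
      sum_distrib_left[symmetric] sum_S
    by (simp flip: r_def t_def)
qed

lemma rho: "(r - t)\<^sup>2 = w * (r - t) + (k - mu)"
  using sum_paths_R sum_paths_T by (simp add: power2_eq_square algebra_simps)

lemma D_square: "D\<^sup>2 = w\<^sup>2 + 4 * (k - mu)"
  using rho by (simp add: D_def power2_eq_square algebra_simps)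

lemma k_square: "k\<^sup>2 = w * k + (k - mu) + 2 * int n * mu"
  using sum_paths_R sum_paths_T by (simp add: k_eq power2_eq_square algebra_simps)

lemma mu_less: "mu < k"
proof -
  have "mu \<noteq> k"
  proof
    assume *: "mu = k"
    then have "k * (k - w - 2 * int n) = 0" using k_square by (simp add: power2_eq_square algebra_simps)
    then have "k = w + 2 * int n" using mu_pos * by auto
    then show False using mu'_pos * w_def by linarith
  qed
  then show ?thesis using mu_le by simp
qed

lemma D_pos: "D > 0"
proof -
  have "D\<^sup>2 > 0" using D_square mu_less by (simp add: add_nonneg_pos)
  then show ?thesis by (simp add: D_def)
qed

text \<open>Supplies the last hypothesis of \<open>cubic_classification\<close>. Equality would mean
  \<open>mu = k\<close> for \<open>j = 0\<close> and \<open>k = 2 * n - 1\<close> for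
  \<open>j = 2\<close>, contradicting \<open>mu_less\<close> and \<open>mu'_pos\<close>;
  \<open>j = 1\<close> fails by parity.\<close>

lemma D_neq: "j \<in> {0..2} \<Longrightarrow> \<bar>- w - j\<bar> \<noteq> D"
proof
  assume j: "j \<in> {0..2}" and eq: "\<bar>- w - j\<bar> = D"
  have "(- w - j)\<^sup>2 = w\<^sup>2 + 4 * (k - mu)" using D_square eq[symmetric] by simp
  then have e: "2 * w * j + j * j = 4 * (k - mu)" by (simp add: power2_eq_square algebra_simps)
  consider "j = 0" | "j = 1" | "j = 2" using j by force
  then show False
  proof cases
    case 1
    then show False using e mu_less by simp
  next
    case 2
    then have "2 * w + 1 = 4 * (k - mu)" using e by simp
    then show False by presburger
  next
    case 3
    then have kw: "k - mu = w + 1" using e by simp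
    have "mu * (k + 1 - 2 * int n) = 0"
      using k_square kw by (simp add: power2_eq_square algebra_simps)
    then have "k + 1 = 2 * int n" using mu_pos by auto
    then show False using mu'_pos kw w_def by linarith
  qed
qed

lemma a_0: "a 0 = - w" by (simp add: a_def R_0 S_0)

lemma periodic_a: "periodic n a"
  using periodic_R periodic_S by (simp add: periodic_def a_def dvd_mod_iff)

lemma a_minus: "a (- g) = a g" by (simp add: a_def R_minus S_minus)

lemma small_a: "small_off_0 n a"
  unfolding small_off_0_def
proof (intro allI impI)
  fix g assume "\<not> int n dvd g"
  then show "a g \<in> {0..2}" using R_range[of g] S_range[of g] by (auto simp: a_def)
qed

lemma cubic_a: "cubic n D a"
proof -
  let ?R = "residue_poly n R" and ?S = "residue_poly n S" and ?T = "residue_poly n T"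
    and ?T' = "residue_poly n (\<lambda>h. T (- h))" and ?Y = "residue_poly n a"
  have lin: "residue_poly n (\<lambda>g. w * A g + (k - mu) * of_bool (int n dvd g)) = of_int w * residue_poly n A + of_int (k - mu)" for A
    unfolding residue_poly_add[symmetric] residue_poly_of_int_mult[symmetric] residue_poly_1[OF n_pos] by simp
  have 1: "cyclic_sum n dvd ?R * ?R + ?T * ?T' - (of_int w * ?R + of_int (k - mu))"
    using cyclic_cong_convolution_sum[OF n_pos periodic_R periodic_T_minus paths_R]
    unfolding cyclic_cong_def by (simp only: lin flip: w_def)
  have 2: "cyclic_sum n dvd ?S * ?S + ?T' * ?T - (of_int w * ?S + of_int (k - mu))"
    using cyclic_cong_convolution_sum[OF n_pos periodic_S periodic_T paths_S]
    unfolding cyclic_cong_def by (simp only: lin flip: w_def)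
  have 3: "cyclic_sum n dvd ?R * ?T + ?T * ?S - of_int w * ?T"
    using cyclic_cong_convolution_sum[OF n_pos periodic_T periodic_S paths_T]
    unfolding cyclic_cong_def by (simp only: residue_poly_of_int_mult flip: w_def)
  have "?Y = residue_poly n (\<lambda>g. R g + S g) - residue_poly n (\<lambda>g. w * of_bool (int n dvd g))"
    unfolding residue_poly_diff a_def[abs_def] ..
  then have Y: "?Y = ?R + ?S - of_int w"
    unfolding residue_poly_delta[OF n_pos] residue_poly_add[symmetric] .
  define E1 E2 E3 where
    "E1 = ?R * ?R + ?T * ?T' - (of_int w * ?R + of_int (k - mu))"
    and "E2 = ?S * ?S + ?T' * ?T - (of_int w * ?S + of_int (k - mu))"
    and "E3 = ?R * ?T + ?T * ?S - of_int w * ?T"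
  have D2: "of_int (D\<^sup>2) = (of_int w)\<^sup>2 + 4 * (of_int (k - mu) :: int poly)" by (simp add: D_square)
  have "?Y ^ 3 - of_int (D\<^sup>2) * ?Y = 2 * ?Y * (E1 + E2) - (?R - ?S) * (E1 - E2) - 4 * ?T' * E3"
    unfolding D2 Y E1_def E2_def E3_def by (rule cubic_identity)
  also have "cyclic_sum n dvd \<dots>"
    using 1 2 3 unfolding E1_def[symmetric] E2_def[symmetric] E3_def[symmetric]
    by (intro dvd_diff dvd_mult dvd_add)
  finally show ?thesis by (simp add: cubic_def cyclic_cong_def)
qed

theorem parameters:
  "(\<exists>s. int n = 2 * s\<^sup>2 + 2 * s + 1 \<and> k = s * (2 * s + 1) \<and> l = s\<^sup>2 - 1 \<and> mu = s\<^sup>2) \<or>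
   (int n = 25 \<and> k = 7 \<and> l = 0 \<and> mu = 1) \<or> (int n = 25 \<and> k = 42 \<and> l = 35 \<and> mu = 36)"
proof -
  have "a 0 \<in> {0..2} \<or> (\<forall>j\<in>{0..2}. \<bar>a 0 - j\<bar> \<noteq> D)" using D_neq by (simp add: a_0)
  from cubic_classification[OF odd_n periodic_a a_minus small_a cubic_a D_pos this]
  obtain d c0 where d: "d dvd n" "\<And>g. a g = (if int d dvd g then a 0 else c0)"
    "a 0 = c0 \<or> D = \<bar>a 0 - c0\<bar> * int (n div d)" by blast
  \<comment> \<open>For \<open>d = 1\<close> no residue lies off the subgroup and \<open>c0\<close>
    is arbitrary; with \<open>a 0\<close> in its place \<open>c\<close> is small as soon as
    \<open>a 0\<close> is.\<close>
  define c where "c = (if d = 1 then a 0 else c0)"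
  have dc: "a g = (if int d dvd g then a 0 else c)" for g
    using d(2)[of g] by (simp add: c_def)
  have or: "a 0 = c \<or> D = \<bar>a 0 - c\<bar> * int (n div d)" using d(3) by (auto simp: c_def)
  have d0: "d > 0" using d(1) n_pos by (auto intro: Nat.gr0I)
  have h: "int n = int d * int (n div d)" using d(1) by (simp flip: of_nat_mult)
  have h0: "n div d > 0" using d(1) n_pos d0 by (simp add: div_greater_zero_iff dvd_imp_le)
  have sm: "a g \<in> {0..2}" if "\<not> int n dvd g" for g using small_a that by (simp add: small_off_0_def)
  have c2: "c \<in> {0..2}" if "d \<noteq> 1"
  proof -
    have "c = a 1" using dc[of 1] that by simp
    moreover have "\<not> int n dvd 1" using n_gt_1 by simp
    ultimately show ?thesis using sm by simp
  qed
  \<comment> \<open>If \<open>d < n\<close>, then \<open>a 0\<close> is also the value at the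
    nonzero residue \<open>d\<close>; if \<open>d = n\<close>, \<open>D_neq\<close> leaves only
    \<open>a 0 = c\<close>.\<close>
  have a2: "a 0 \<in> {0..2}"
  proof (cases "d = n")
    case True
    then have "c \<in> {0..2}" using c2 n_gt_1 by simp
    moreover have "D \<noteq> \<bar>a 0 - c\<bar>" using D_neq[OF calculation] by (simp add: a_0)
    ultimately show ?thesis using or True n_pos by auto
  next
    case False
    then have "d < n" using d(1) n_pos dvd_imp_le by (metis le_neq_implies_less)
    then have "\<not> int n dvd int d" using d0 by (auto dest: zdvd_imp_le)
    then have "a (int d) \<in> {0..2}" by (rule sm)
    then show ?thesis using dc[of "int d"] by simp
  qed
  have c2': "c \<in> {0..2}" using a2 c2 by (cases "d = 1") (simp_all add: c_def)
  have "2 * r - w = (\<Sum>i<n. a (int i))"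
    unfolding a_def sum_subtractf sum.distrib sum_S sum_distrib_left[symmetric] sum_delta by (simp add: r_def)
  also have "\<dots> = (\<Sum>i<n. c + (a 0 - c) * of_bool (d dvd i))"
    by (intro sum.cong refl) (simp add: dc[of "int _"])
  also have "\<dots> = c * int n + (a 0 - c) * int (card {i. i < n \<and> d dvd i})"
  proof -
    have "(\<Sum>i<n. of_bool (d dvd i)) = int (card {i. i < n \<and> d dvd i})"
      by (simp add: of_bool_def sum.If_cases Int_def)
    then show ?thesis by (simp add: sum.distrib flip: sum_distrib_left)
  qed
  also have "\<dots> = c * (int n - int (n div d)) + a 0 * int (n div d)"
    unfolding card_multiples_below[OF d(1) n_pos] by (simp add: algebra_simps)
  finally have r: "2 * r + a 0 = c * (int n - int (n div d)) + a 0 * int (n div d)" by (simp add: a_0)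
  show ?thesis
  proof (rule parameter_classification[OF _ _ h _ k_eq mu_pos mu'_pos _ _ D_pos _ _ a2 c2' r or])
    show "int n > 1" "odd (int n)" using n_gt_1 odd_n by simp_all
    show "int (n div d) > 0" using h0 by simp
    show "a 0 = mu - l" by (simp add: a_0 w_def)
  qed (use rho sum_paths_T D_square in \<open>simp_all add: w_def\<close>)
qed

end

section \<open>Isoregular pairs\<close>

text \<open>The three double counts obtained from a 3-isoregular pair: \<open>a\<close>, \<open>b\<close>, \<open>c\<close> are the valencies of the
  triples with two, one and no further adjacencies to the pair, \<open>g\<close> is the valency of the pair and
  \<open>j\<close> indicates whether the pair is an edge.\<close>

definition isoregular_counts :: "int \<Rightarrow> int \<Rightarrow> int \<Rightarrow> int \<Rightarrow> int \<Rightarrow> int \<Rightarrow> int \<Rightarrow> int \<Rightarrow> int \<Rightarrow> bool" where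
  "isoregular_counts v k l mu j g a b c \<longleftrightarrow>
    (let e = a - 2 * b + c; w = l - mu; u = g - c - (b - c) * j in
      k * g = v * c + 2 * (b - c) * k + e * g + 2 * u \<and>
      mu * g + (w - e) * g = c * k + 2 * mu * (b - c) + (w * (b - c) + u) * j + (k - mu) * (b - c) \<and>
      mu * g + (w - e) * a + (k - mu) = c * k + 2 * mu * (b - c) + 2 * (w * (b - c) + u))"

section \<open>Integrality of the counts for the surviving parameters\<close>

text \<open>The first two counts are linear and express \<open>a\<close>, \<open>b\<close> and
  \<open>(s + 1) * c\<close> by one integer \<open>m\<close>; the third then factors. One factor
  gives \<open>2 * m = s + 1\<close>; the other would make \<open>2 * s^2 - 1\<close> divide
  \<open>3 * s + 2\<close>, impossible for \<open>|s| \<ge> 2\<close>.\<close>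

lemma adjacent_counts_imp_odd:
  assumes "isoregular_counts (2 * (2 * s\<^sup>2 + 2 * s + 1)) (s * (2 * s + 1)) (s\<^sup>2 - 1) (s\<^sup>2) 1 (s\<^sup>2 - 1) a b c"
    and s: "s \<ge> 2 \<or> s \<le> -2"
  shows "odd s"
proof -
  from assms(1) have
    S: "s * (2 * s + 1) * (s\<^sup>2 - 1) = 2 * (2 * s\<^sup>2 + 2 * s + 1) * c + 2 * (b - c) * (s * (2 * s + 1)) + (a - 2 * b + c) * (s\<^sup>2 - 1) + 2 * (s\<^sup>2 - 1 - b)"
    and X: "s\<^sup>2 * (s\<^sup>2 - 1) + (- 1 - (a - 2 * b + c)) * (s\<^sup>2 - 1) =
       c * (s * (2 * s + 1)) + 2 * s\<^sup>2 * (b - c) + (- (b - c) + (s\<^sup>2 - 1 - b)) + (s * (2 * s + 1) - s\<^sup>2) * (b - c)"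
    and U: "s\<^sup>2 * (s\<^sup>2 - 1) + (- 1 - (a - 2 * b + c)) * a + (s * (2 * s + 1) - s\<^sup>2) =
       c * (s * (2 * s + 1)) + 2 * s\<^sup>2 * (b - c) + 2 * (- (b - c) + (s\<^sup>2 - 1 - b))"
    by (simp_all add: isoregular_counts_def Let_def)
  have "(s + 1) * ((s - 1) * (s\<^sup>2 - 2 - a) - s * b) = 0" using X
    by (simp add: algebra_simps power2_eq_square power3_eq_cube)
  then have 1: "(s - 1) * (s\<^sup>2 - 2 - a) = s * b" using s by auto
  \<comment> \<open>As \<open>s - 1\<close> and \<open>s\<close> are coprime, both sides of the
    relation equal \<open>(s - 1) * s * m\<close> for an integer \<open>m\<close>, found as the
    difference of the two cofactors.\<close>
  define m where "m = (s\<^sup>2 - 2 - a) - b"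
  have a: "a = s\<^sup>2 - 2 - s * m" using 1 by (simp add: m_def algebra_simps)
  have b: "b = (s - 1) * m" using a by (simp add: m_def algebra_simps)
  have "(s + 1) * ((s - 1) * s * m - (s + 1) * ((s - 1) * s - c)) = 0" using S unfolding a b
    by (simp add: algebra_simps power2_eq_square power3_eq_cube)
  then have "(s - 1) * s * m - (s + 1) * ((s - 1) * s - c) = 0"
    using s unfolding mult_eq_0_iff[of "s + 1"] by linarith
  then have 2: "(s + 1) * c = (s + 1) * (s - 1) * s - (s - 1) * s * m" by (simp add: algebra_simps)
  \<comment> \<open>The third count is multiplied by \<open>s + 1\<close> so that the relation for
    \<open>(s + 1) * c\<close> can eliminate \<open>c\<close>.\<close>
  have "s * (2 * m - (s + 1)) * ((2 * s\<^sup>2 - 1) * m - (s\<^sup>2 - s - 1) * (s + 1)) =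
      (s + 1) * ((c * (s * (2 * s + 1)) + 2 * s\<^sup>2 * (b - c) + 2 * (- (b - c) + (s\<^sup>2 - 1 - b))) -
        (s\<^sup>2 * (s\<^sup>2 - 1) + (- 1 - (a - 2 * b + c)) * a + (s * (2 * s + 1) - s\<^sup>2))) +
      (s * m - s\<^sup>2 - s) * ((s + 1) * c - ((s + 1) * (s - 1) * s - (s - 1) * s * m))"
    unfolding a b by (simp add: algebra_simps power2_eq_square)
  also have "\<dots> = 0" using U 2 by simp
  finally have "s * (2 * m - (s + 1)) * ((2 * s\<^sup>2 - 1) * m - (s\<^sup>2 - s - 1) * (s + 1)) = 0" .
  then consider "2 * m = s + 1" | "(2 * s\<^sup>2 - 1) * m = (s\<^sup>2 - s - 1) * (s + 1)" using s by auto
  then show ?thesis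
  proof cases
    case 1
    then show ?thesis by presburger
  next
    case 2
    then have "(2 * s\<^sup>2 - 1) * (s - 2 * m) = 3 * s + 2"
      by (simp add: algebra_simps power2_eq_square power3_eq_cube)
    then have dvd: "2 * s\<^sup>2 - 1 dvd 3 * s + 2" by (metis dvd_triv_left)
    have "3 * s + 2 \<noteq> 0" by presburger
    then have le: "\<bar>2 * s\<^sup>2 - 1\<bar> \<le> \<bar>3 * s + 2\<bar>" using dvd by (rule dvd_imp_le_int)
    show ?thesis
    proof (cases "s \<ge> 3 \<or> s \<le> -3")
      case True
      then have "3 * \<bar>s\<bar> \<le> \<bar>s\<bar> * \<bar>s\<bar>" by (intro mult_right_mono) auto
      then have "2 * s\<^sup>2 \<ge> 6 * \<bar>s\<bar>" by (simp add: power2_eq_square)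
      then show ?thesis using le True by linarith
    next
      case False
      then have "s = 2 \<or> s = -2" using s by auto
      then show ?thesis using dvd by auto
    qed
  qed
qed

text \<open>The same elimination ends in \<open>2 * m = s\<close> or in
  \<open>2 * s^2 + 4 * s + 1\<close> dividing \<open>s + 1\<close>, which is too small since
  \<open>|s + 1| \<ge> 2\<close>.\<close>

lemma nonadjacent_counts_imp_even:
  assumes "isoregular_counts (2 * (2 * s\<^sup>2 + 2 * s + 1)) (s * (2 * s + 1)) (s\<^sup>2 - 1) (s\<^sup>2) 0 (s\<^sup>2) a b c"
    and s: "s \<noteq> 0" "s \<noteq> -1" "s \<noteq> -2"
  shows "even s"
proof -
  from assms(1) have
    S: "s * (2 * s + 1) * s\<^sup>2 = 2 * (2 * s\<^sup>2 + 2 * s + 1) * c + 2 * (b - c) * (s * (2 * s + 1)) + (a - 2 * b + c) * s\<^sup>2 + 2 * (s\<^sup>2 - c)"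
    and X: "s\<^sup>2 * s\<^sup>2 + (- 1 - (a - 2 * b + c)) * s\<^sup>2 =
       c * (s * (2 * s + 1)) + 2 * s\<^sup>2 * (b - c) + (s * (2 * s + 1) - s\<^sup>2) * (b - c)"
    and U: "s\<^sup>2 * s\<^sup>2 + (- 1 - (a - 2 * b + c)) * a + (s * (2 * s + 1) - s\<^sup>2) =
       c * (s * (2 * s + 1)) + 2 * s\<^sup>2 * (b - c) + 2 * (- (b - c) + (s\<^sup>2 - c))"
    by (simp_all add: isoregular_counts_def Let_def)
  have "s * (s * (s\<^sup>2 - 1 - a) - (s + 1) * b) = 0" using X
    by (simp add: algebra_simps power2_eq_square power3_eq_cube)
  then have 1: "s * (s\<^sup>2 - 1 - a) = (s + 1) * b" using s by auto
  define m where "m = (s\<^sup>2 - 1 - a) - b"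
  have b: "b = s * m" using 1 by (simp add: m_def algebra_simps)
  have a: "a = s\<^sup>2 - 1 - (s + 1) * m" using b by (simp add: m_def algebra_simps)
  have "s * (s * (s + 1) * m + (s + 2) * c - s * (s\<^sup>2 + s - 1)) = 0" using S unfolding a b
    by (simp add: algebra_simps power2_eq_square power3_eq_cube)
  then have "s * (s + 1) * m + (s + 2) * c - s * (s\<^sup>2 + s - 1) = 0"
    using s(1) unfolding mult_eq_0_iff[of s] by blast
  then have 2: "(s + 2) * c = s * (s\<^sup>2 + s - 1) - s * (s + 1) * m" by simp
  have "(s + 1) * (2 * m - s) * ((2 * s\<^sup>2 + 4 * s + 1) * m - (s ^ 3 + s\<^sup>2 - 2 * s - 1)) =
      (s + 2) * ((c * (s * (2 * s + 1)) + 2 * s\<^sup>2 * (b - c) + 2 * (- (b - c) + (s\<^sup>2 - c))) -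
        (s\<^sup>2 * s\<^sup>2 + (- 1 - (a - 2 * b + c)) * a + (s * (2 * s + 1) - s\<^sup>2))) +
      ((s + 1) * m - s\<^sup>2 - s + 1) * ((s + 2) * c - (s * (s\<^sup>2 + s - 1) - s * (s + 1) * m))"
    unfolding a b by (simp add: algebra_simps power2_eq_square power3_eq_cube)
  also have "\<dots> = 0" using U 2 by simp
  finally have "(s + 1) * (2 * m - s) * ((2 * s\<^sup>2 + 4 * s + 1) * m - (s ^ 3 + s\<^sup>2 - 2 * s - 1)) = 0" .
  then consider "2 * m = s" | "(2 * s\<^sup>2 + 4 * s + 1) * m = s ^ 3 + s\<^sup>2 - 2 * s - 1" using s by auto
  then show ?thesis
  proof cases
    case 1
    then show ?thesis by presburger
  next
    case 2
    then have "(2 * s\<^sup>2 + 4 * s + 1) * (s - 1 - 2 * m) = s + 1"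
      by (simp add: algebra_simps power2_eq_square power3_eq_cube)
    then have dvd: "2 * s\<^sup>2 + 4 * s + 1 dvd s + 1" by (metis dvd_triv_left)
    have "s + 1 \<noteq> 0" using s by simp
    then have "\<bar>2 * s\<^sup>2 + 4 * s + 1\<bar> \<le> \<bar>s + 1\<bar>" using dvd by (rule dvd_imp_le_int)
    then have "2 * s\<^sup>2 + 4 * s + 1 \<le> \<bar>s + 1\<bar>" by (rule order.trans[OF abs_ge_self])
    moreover define y where "y = \<bar>s + 1\<bar>"
    moreover have "2 * s\<^sup>2 + 4 * s + 1 = 2 * (y * y) - 1" by (simp add: y_def power2_eq_square algebra_simps)
    ultimately have "2 * (y * y) - 1 \<le> y" by simp
    moreover have y2: "y \<ge> 2" using s by (auto simp: y_def)
    moreover have "y * y \<ge> 2 * y" using y2 by (intro mult_right_mono) auto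
    ultimately show ?thesis by linarith
  qed
qed

text \<open>Elimination leaves \<open>q * (2002 * q + 581) = - 42\<close>, whose left side is never
  negative at an integer.\<close>

lemma Hoffman_Singleton_counts: "\<not> isoregular_counts 50 7 0 1 0 1 a b c"
proof
  assume "isoregular_counts 50 7 0 1 0 1 a b c"
  then have S: "7 = 50 * c + 2 * (b - c) * 7 + (a - 2 * b + c) + 2 * (1 - c)"
    and X: "1 + (- 1 - (a - 2 * b + c)) = 7 * c + 2 * (b - c) + 6 * (b - c)"
    and U: "1 + (- 1 - (a - 2 * b + c)) * a + 6 = c * 7 + 2 * (b - c) + 2 * (- (b - c) + (1 - c))"
    by (simp_all add: isoregular_counts_def Let_def)
  have a: "a = - 6 * b" using X by simp
  have 1: "6 * b = 5 - 35 * c" using S a by simp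
  define q where "q = 6 * c + b - 1"
  have c: "c = 6 * q + 1" using 1 by (simp add: q_def)
  have b: "b = - 5 - 35 * q" using 1 c by simp
  have "q * (2002 * q + 581) = - 42" using U unfolding a b c by (simp add: algebra_simps)
  moreover have "q * (2002 * q + 581) \<ge> 0"
    by (cases "q \<ge> 0") (auto intro: mult_nonpos_nonpos)
  ultimately show False by simp
qed

text \<open>Elimination leaves \<open>q * (286 * q - 489) = - 209\<close>; the left side is
  nonnegative except at \<open>q = 1\<close>, where it is -203.\<close>

lemma complement_Hoffman_Singleton_counts: "\<not> isoregular_counts 50 42 35 36 1 35 a b c"
proof
  assume "isoregular_counts 50 42 35 36 1 35 a b c"
  then have S: "42 * 35 = 50 * c + 2 * (b - c) * 42 + (a - 2 * b + c) * 35 + 2 * (35 - b)"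
    and X: "36 * 35 + (- 1 - (a - 2 * b + c)) * 35 = c * 42 + 72 * (b - c) + (- (b - c) + (35 - b)) + 6 * (b - c)"
    and U: "36 * 35 + (- 1 - (a - 2 * b + c)) * a + 6 = c * 42 + 72 * (b - c) + 2 * (- (b - c) + (35 - b))"
    by (simp_all add: isoregular_counts_def Let_def)
  have 1: "35 * (34 - a) = 6 * b" using X by simp
  define q where "q = 6 * (34 - a) - b"
  have b: "b = 35 * q" using 1 by (simp add: q_def)
  have a: "a = 34 - 6 * q" using 1 b by simp
  have c: "c = 210 - 210 * q" using S a b by simp
  have q: "q * (286 * q - 489) = - 209" using U unfolding a b c by (simp add: algebra_simps)
  consider "q \<le> 0" | "q = 1" | "q \<ge> 2" by linarith
  then have "q * (286 * q - 489) \<noteq> - 209"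
  proof cases
    case 1
    then have "q * (286 * q - 489) \<ge> 0" by (intro mult_nonpos_nonpos) auto
    then show ?thesis by linarith
  next
    case 3
    then have "q * (286 * q - 489) \<ge> 0" by (intro mult_nonneg_nonneg) auto
    then show ?thesis by linarith
  qed simp
  then show False using q by contradiction
qed

section \<open>From a 3-isoregular pair to the counts\<close>

lemma digraph_iso_triple:
  assumes G: "pair_graph G"
    and d: "x \<noteq> y" "x \<noteq> z" "y \<noteq> z" "x' \<noteq> y'" "x' \<noteq> z'" "y' \<noteq> z'"
    and xy: "(x, y) \<in> parcs G \<longleftrightarrow> (x', y') \<in> parcs G"
    and xz: "(x, z) \<in> parcs G \<longleftrightarrow> (x', z') \<in> parcs G"
    and yz: "(y, z) \<in> parcs G \<longleftrightarrow> (y', z') \<in> parcs G"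
  shows "digraph_iso (with_proj G \<restriction> {x, y, z}) (with_proj G \<restriction> {x', y', z'})"
proof -
  interpret pair_graph G by fact
  have sym: "(u, v) \<in> parcs G \<longleftrightarrow> (v, u) \<in> parcs G" for u v
    using pair_sym_arcs by (auto simp: symmetric_def sym_def)
  have irr: "(u, u) \<notin> parcs G" for u using pair_no_loops by fastforce
  define h where "h v = (if v = x then x' else if v = y then y' else z')" for v
  have hv: "h x = x'" "h y = y'" "h z = z'" using d by (auto simp: h_def)
  have pres: "(h u, h v) \<in> parcs G \<longleftrightarrow> (u, v) \<in> parcs G" if "u \<in> {x, y, z}" "v \<in> {x, y, z}" for u v
    using that xy xz yz sym irr by (auto simp: hv)
  have img: "h ` {x, y, z} = {x', y', z'}" using hv by auto
  have inj: "inj_on h {x, y, z}" using d hv by (auto simp: inj_on_def)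
  let ?A = "{e \<in> parcs G. fst e \<in> {x, y, z} \<and> snd e \<in> {x, y, z}}"
  let ?B = "{e \<in> parcs G. fst e \<in> {x', y', z'} \<and> snd e \<in> {x', y', z'}}"
  have arcs: "map_prod h h ` ?A = ?B"
  proof (intro equalityI subsetI)
    fix e assume "e \<in> map_prod h h ` ?A"
    then obtain u v where uv: "e = (h u, h v)" "(u, v) \<in> parcs G" "u \<in> {x, y, z}" "v \<in> {x, y, z}" by auto
    then show "e \<in> ?B" using pres[OF uv(3,4)] img by auto
  next
    fix e assume e: "e \<in> ?B"
    then obtain u v where uv: "e = (h u, h v)" "u \<in> {x, y, z}" "v \<in> {x, y, z}"
      unfolding img[symmetric] by (cases e) auto
    then have "(u, v) \<in> parcs G" using e pres[OF uv(2,3)] by auto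
    then have "(u, v) \<in> ?A" using uv by auto
    then show "e \<in> map_prod h h ` ?A" by (rule rev_image_eqI) (simp add: uv(1))
  qed
  define hom where "hom = \<lparr> iso_verts = h, iso_arcs = map_prod h h, iso_head = snd, iso_tail = fst \<rparr>"
  have "pre_digraph.digraph_isomorphism (with_proj G \<restriction> {x, y, z}) hom"
    unfolding pre_digraph.digraph_isomorphism_def
  proof (intro conjI)
    show "wf_digraph (with_proj G \<restriction> {x, y, z})" by (rule wellformed_induce_subgraph)
    show "inj_on (iso_verts hom) (verts (with_proj G \<restriction> {x, y, z}))" using inj by (simp add: hom_def)
    have "inj_on (map_prod h h) ({x, y, z} \<times> {x, y, z})" by (rule map_prod_inj_on[OF inj inj])
    then have "inj_on (map_prod h h) ?A" 
      by (rule inj_on_subset) (simp only: subset_iff mem_Collect_eq mem_Times_iff, iprover)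
    then show "inj_on (iso_arcs hom) (arcs (with_proj G \<restriction> {x, y, z}))" by (simp add: hom_def)
  qed (simp add: hom_def)
  moreover have "with_proj G \<restriction> {x', y', z'} = app_iso hom (with_proj G \<restriction> {x, y, z})"
    using arcs img unfolding app_iso_def hom_def induce_subgraph_def by simp
  ultimately show ?thesis unfolding digraph_iso_def by blast
qed

locale srg_graph =
  fixes G :: "'a pair_pre_digraph" and N k l m :: nat
  assumes srg: "strongly_regular G N k l m"
begin

abbreviation "V \<equiv> pverts G"

definition adj :: "'a \<Rightarrow> 'a \<Rightarrow> int" where
  "adj u v = of_bool ((u, v) \<in> parcs G)"

definition "w = int l - int m"
definition "\<kappa> = int k - int m"

lemma G: "pair_graph G" and card_V: "card V = N"
  using srg by (auto simp: strongly_regular_def)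

lemma finite_V: "finite V"
proof -
  interpret pair_graph G by (rule G)
  show ?thesis by (rule pair_finite_verts)
qed

lemma arc_verts: "(u, v) \<in> parcs G \<Longrightarrow> u \<in> V" "(u, v) \<in> parcs G \<Longrightarrow> v \<in> V"
proof -
  interpret pair_graph G by (rule G)
  show "(u, v) \<in> parcs G \<Longrightarrow> u \<in> V" "(u, v) \<in> parcs G \<Longrightarrow> v \<in> V"
    using arc_fst_in_verts arc_snd_in_verts by fastforce+
qed

lemma arc_sym: "(u, v) \<in> parcs G \<longleftrightarrow> (v, u) \<in> parcs G"
proof -
  interpret pair_graph G by (rule G)
  show ?thesis using pair_sym_arcs by (auto simp: symmetric_def sym_def)
qed

lemma arc_irrefl: "(u, u) \<notin> parcs G"
proof -
  interpret pair_graph G by (rule G)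
  show ?thesis using pair_no_loops by fastforce
qed

lemma adj_sym: "adj u v = adj v u" using arc_sym by (simp add: adj_def)

lemma adj_refl [simp]: "adj u u = 0" by (simp add: adj_def arc_irrefl)

lemma adj_cases: "adj u v = 0 \<or> adj u v = 1" by (simp add: adj_def)

lemma adj_idem: "adj u v * adj u v = adj u v" by (simp add: adj_def)

lemma adj_idem': "adj u v * adj v u = adj u v"
  using adj_idem[of u v] adj_sym[of u v] by simp

lemma valency_conv_sum: "finite T \<Longrightarrow> int (valency G T) = (\<Sum>z\<in>V. \<Prod>t\<in>T. adj z t)"
proof -
  assume T: "finite T"
  have "(\<Prod>t\<in>T. adj z t) = of_bool (\<forall>t\<in>T. (z, t) \<in> parcs G)" for z
    using T by (induction T) (auto simp: adj_def)
  then show ?thesis using finite_V by (simp add: valency_def neighbours_def of_bool_def sum.If_cases Int_def)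
qed

lemma degree: "u \<in> V \<Longrightarrow> (\<Sum>z\<in>V. adj u z) = int k"
  using srg valency_conv_sum[of "{u}"] by (simp add: strongly_regular_def adj_sym)

lemma paths:
  assumes "u \<in> V" "v \<in> V"
  shows "(\<Sum>z\<in>V. adj u z * adj z v) = int m + w * adj u v + \<kappa> * of_bool (u = v)"
proof (cases "u = v")
  case True
  then show ?thesis using degree[OF assms(1)] by (simp add: adj_idem' \<kappa>_def)
next
  case False
  have "(\<Sum>z\<in>V. adj u z * adj z v) = int (valency G {u, v})"
    using False by (simp add: valency_conv_sum adj_sym[of u])
  also have "\<dots> = (if (u, v) \<in> parcs G then int l else int m)"
    using srg assms False by (simp add: strongly_regular_def)
  also have "\<dots> = int m + w * adj u v + \<kappa> * of_bool (u = v)"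
    using False by (simp add: adj_def w_def)
  finally show ?thesis .
qed

lemma sum_at:
  fixes A :: "'a \<Rightarrow> int"
  assumes "v \<in> V"
  shows "(\<Sum>z\<in>V. A z * of_bool (z = v)) = A v"
proof -
  have "(\<Sum>z\<in>V. A z * of_bool (z = v)) = (\<Sum>z\<in>V. if z = v then A z else 0)"
    by (intro sum.cong refl) simp
  then show ?thesis using assms finite_V by simp
qed

text \<open>\<open>F\<close> is the adjacency matrix applied to the indicator \<open>C\<close> of
  the common neighbours of the pair. Isoregularity expresses \<open>F\<close> by constants, the
  neighbourhoods of \<open>x\<close> and \<open>y\<close>, \<open>C\<close> and the two points. The
  counts arise from the sum of \<open>F\<close> and from applying the matrix once more, at
  \<open>x\<close> and at a common neighbour, which the second hypothesis provides.\<close>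

lemma isoregular_pair_counts:
  assumes "isoregular3_pair G x y" and "(\<Sum>z\<in>V. adj x z * adj y z) > 0"
  shows "\<exists>a b c. isoregular_counts (int N) (int k) (int l) (int m) (adj x y) (int m + w * adj x y) a b c"
proof -
  have x: "x \<in> V" and y: "y \<in> V" and xy: "x \<noteq> y"
    and iso: "\<And>z z'. z \<in> V - {x, y} \<Longrightarrow> z' \<in> V - {x, y} \<Longrightarrow>
       digraph_iso (with_proj G \<restriction> {x, y, z}) (with_proj G \<restriction> {x, y, z'}) \<Longrightarrow>
       valency G {x, y, z} = valency G {x, y, z'}"
    using assms(1) by (auto simp: isoregular3_pair_def)
  define C where "C z = adj x z * adj y z" for z
  define F where "F z = (\<Sum>v\<in>V. adj z v * C v)" for z
  define g where "g = (\<Sum>z\<in>V. C z)"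
  have g: "g = int m + w * adj x y"
    using paths[OF x y] xy by (simp add: g_def C_def adj_sym[of y])
  have F: "F z = int (valency G {x, y, z})" if "z \<noteq> x" "z \<noteq> y" for z
    using that xy by (simp add: valency_conv_sum F_def C_def adj_sym[of z] adj_sym[of x] adj_sym[of y] mult_ac)
  \<comment> \<open>With the pair fixed, the number of further adjacencies determines the
    isomorphism type; if it is 1, \<open>x\<close> and \<open>y\<close> may have to be
    exchanged.\<close>
  have same: "F z = F z'"
    if "z \<in> V - {x, y}" "z' \<in> V - {x, y}" "adj x z + adj y z = adj x z' + adj y z'" for z z'
  proof -
    have "adj x z = adj x z' \<and> adj y z = adj y z' \<or> adj x z = adj y z' \<and> adj y z = adj x z'"
      using that(3) adj_cases[of x z] adj_cases[of y z] adj_cases[of x z'] adj_cases[of y z'] by auto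
    then have "digraph_iso (with_proj G \<restriction> {x, y, z}) (with_proj G \<restriction> {x, y, z'})"
    proof
      assume "adj x z = adj x z' \<and> adj y z = adj y z'"
      then show ?thesis using that xy by (intro digraph_iso_triple[OF G]) (auto simp: adj_def)
    next
      assume "adj x z = adj y z' \<and> adj y z = adj x z'"
      then have "digraph_iso (with_proj G \<restriction> {x, y, z}) (with_proj G \<restriction> {y, x, z'})"
        using that xy arc_sym[of x y] by (intro digraph_iso_triple[OF G]) (auto simp: adj_def)
      then show ?thesis by (simp add: insert_commute)
    qed
    from iso[OF that(1,2) this] show ?thesis using F that by simp
  qed
  have "\<exists>f. \<forall>z\<in>V - {x, y}. adj x z + adj y z = i \<longrightarrow> F z = f" for i
    using same by (cases "\<exists>z\<in>V - {x, y}. adj x z + adj y z = i") blast+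
  then obtain f where f: "\<And>i z. z \<in> V - {x, y} \<Longrightarrow> adj x z + adj y z = i \<Longrightarrow> F z = f i" by metis
  \<comment> \<open>Interpolation: \<open>c + (b - c) * i\<close> is right for \<open>i = 0\<close>
    and \<open>i = 1\<close>, \<open>e\<close> corrects \<open>i = 2\<close>, where \<open>C\<close>
    is 1, and \<open>u\<close> corrects the points \<open>x\<close> and \<open>y\<close>.\<close>
  define a b c e u where "a = f 2" and "b = f 1" and "c = f 0" and "e = a - 2 * b + c"
    and "u = g - c - (b - c) * adj x y"
  have Fx: "F x = g" "F y = g"
    unfolding F_def g_def C_def by (intro sum.cong refl; simp add: adj_def)+
  have Feq: "F z = c + (b - c) * (adj x z + adj y z) + e * C z + u * (of_bool (z = x) + of_bool (z = y))"
    if zV: "z \<in> V" for z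
  proof -
    consider "z = x" | "z = y" | "z \<in> V - {x, y}" using zV by blast
    then show ?thesis
    proof cases
      case 1
      then show ?thesis using xy Fx by (simp add: C_def u_def adj_sym[of y])
    next
      case 2
      then show ?thesis using xy Fx by (simp add: C_def u_def)
    next
      case 3
      then show ?thesis
        using f[OF 3 refl] adj_cases[of x z] adj_cases[of y z]
        by (auto simp: a_def b_def c_def e_def C_def)
    qed
  qed
  have sx: "(\<Sum>z\<in>V. A z * of_bool (z = x)) = A x" "(\<Sum>z\<in>V. A z * of_bool (z = y)) = A y" for A :: "'a \<Rightarrow> int"
    by (simp_all only: sum_at x y)
  have E: "int m * g + (w - e) * F v + \<kappa> * C v =
      c * int k + 2 * int m * (b - c) + (w * (b - c) + u) * (adj x v + adj y v)
      + \<kappa> * (b - c) * (of_bool (v = x) + of_bool (v = y))" if v: "v \<in> V" for v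
  proof -
    have "(\<Sum>z\<in>V. adj v z * F z) = (\<Sum>s\<in>V. (\<Sum>z\<in>V. adj v z * adj z s) * C s)"
      unfolding F_def sum_distrib_left sum_distrib_right by (subst sum.swap) (simp add: mult.assoc)
    also have "\<dots> = (\<Sum>s\<in>V. (int m + w * adj v s + \<kappa> * of_bool (v = s)) * C s)"
      using paths[OF v] by (intro sum.cong refl) simp
    also have "\<dots> = int m * g + w * F v + \<kappa> * (\<Sum>s\<in>V. C s * of_bool (s = v))"
      by (simp add: F_def g_def algebra_simps sum.distrib sum_distrib_left eq_commute)
    also have "(\<Sum>s\<in>V. C s * of_bool (s = v)) = C v"
      by (rule sum_at[OF v])
    finally have 1: "(\<Sum>z\<in>V. adj v z * F z) = int m * g + w * F v + \<kappa> * C v" .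
    have "(\<Sum>z\<in>V. adj v z * F z) = (\<Sum>z\<in>V. c * adj v z + (b - c) * (adj v z * adj z x) + (b - c) * (adj v z * adj z y)
        + e * (adj v z * C z) + (u * adj v z) * of_bool (z = x) + (u * adj v z) * of_bool (z = y))"
      by (intro sum.cong refl) (simp add: Feq adj_sym[of x] adj_sym[of y] algebra_simps)
    also have "\<dots> = c * int k + (b - c) * (int m + w * adj v x + \<kappa> * of_bool (v = x))
        + (b - c) * (int m + w * adj v y + \<kappa> * of_bool (v = y)) + e * F v + u * adj v x + u * adj v y"
      unfolding sum.distrib sx sum_distrib_left[symmetric] degree[OF v] paths[OF v x] paths[OF v y] F_def ..
    finally show ?thesis using 1 by (simp add: adj_sym[of v] algebra_simps)
  qed
  have "(\<Sum>z\<in>V. F z) = int k * g"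
  proof -
    have "(\<Sum>z\<in>V. F z) = (\<Sum>s\<in>V. (\<Sum>z\<in>V. adj s z) * C s)"
      unfolding F_def sum_distrib_right by (subst sum.swap) (simp add: adj_sym)
    also have "\<dots> = (\<Sum>s\<in>V. int k * C s)" by (intro sum.cong refl) (simp add: degree)
    finally show ?thesis by (simp add: g_def sum_distrib_left)
  qed
  moreover have "(\<Sum>z\<in>V. F z) = (\<Sum>z\<in>V. c + (b - c) * adj x z + (b - c) * adj y z + e * C z
      + u * of_bool (z = x) + u * of_bool (z = y))"
    by (intro sum.cong refl) (simp add: Feq algebra_simps)
  moreover have "\<dots> = int N * c + (b - c) * int k + (b - c) * int k + e * g + u + u"
    unfolding sum.distrib sx sum_distrib_left[symmetric] degree[OF x] degree[OF y] g_def
    using sx[of "\<lambda>_. 1"] by (simp add: card_V)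
  ultimately have S: "int k * g = int N * c + 2 * (b - c) * int k + e * g + 2 * u"
    by (simp add: algebra_simps)
  have X: "int m * g + (w - e) * g = c * int k + 2 * int m * (b - c) + (w * (b - c) + u) * adj x y + \<kappa> * (b - c)"
    using E[OF x] Fx xy by (simp add: C_def adj_sym[of y])
  obtain v where v: "v \<in> V" "C v \<noteq> 0"
    using assms(2) unfolding C_def[symmetric] by (metis less_irrefl sum.neutral)
  then have av: "adj x v = 1" "adj y v = 1" using adj_cases[of x v] adj_cases[of y v] by (auto simp: C_def)
  then have "v \<noteq> x" "v \<noteq> y" using adj_refl by auto
  moreover from this have "F v = a" using f[of v 2] v(1) av by (simp add: a_def)
  ultimately have U: "int m * g + (w - e) * a + \<kappa> = c * int k + 2 * int m * (b - c) + 2 * (w * (b - c) + u)"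
    using E[OF v(1)] av by (simp add: C_def)
  have "isoregular_counts (int N) (int k) (int l) (int m) (adj x y) g a b c"
    using S X U unfolding isoregular_counts_def Let_def u_def e_def w_def \<kappa>_def by blast
  then show ?thesis unfolding g by blast
qed

end

section \<open>Bicirculants\<close>

text \<open>Connectedness speaks of paths in the symmetric closure, hence the two orientations in
  the conclusion.\<close>

lemma connected_leaving_arc:
  assumes "Digraph_Component.connected (with_proj H)"
    and "x \<in> pverts H" "y \<in> pverts H" "x \<in> U" "y \<notin> U"
  shows "\<exists>u v. u \<in> U \<and> v \<notin> U \<and> ((u, v) \<in> parcs H \<or> (v, u) \<in> parcs H)"
proof (rule ccontr)
  assume no: "\<not> ?thesis"
  have "x \<rightarrow>\<^sup>*\<^bsub>with_proj (mk_symmetric (with_proj H))\<^esub> y"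
    using assms by (auto simp: Digraph_Component.connected_def strongly_connected_def mk_symmetric_def)
  then have "(x, y) \<in> (parcs (mk_symmetric (with_proj H)))\<^sup>*"
    using reachable_rtranclI by fastforce
  then have "y \<in> U"
  proof (induction rule: rtrancl_induct)
    case base
    then show ?case by (rule assms)
  next
    case (step u v)
    have "(u, v) \<in> parcs H \<or> (v, u) \<in> parcs H" using step(2) by (auto simp: mk_symmetric_def)
    then show ?case using no step(3) by blast
  qed
  then show False using assms(5) by simp
qed

locale nontrivial_srg = srg_graph G N k l m for G :: "'a pair_pre_digraph" and N k l m +
  assumes nontriv: "nontrivial G" and N_ge_2: "N \<ge> 2"
begin

lemma conn: "Digraph_Component.connected (with_proj G)"
  and conn': "Digraph_Component.connected (with_proj (complement_graph G))"
  using nontriv by (auto simp: nontrivial_def)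

lemma ex_other:
  assumes "x \<in> V"
  shows "\<exists>y\<in>V. y \<noteq> x"
proof (rule ccontr)
  assume "\<not> ?thesis"
  then have "V \<subseteq> {x}" by auto
  then have "card V \<le> 1" using card_mono[of "{x}" V] by simp
  then show False using N_ge_2 card_V by simp
qed

lemma ex_neighbour:
  assumes "x \<in> V"
  shows "\<exists>y. (x, y) \<in> parcs G"
proof -
  obtain y where "y \<in> V" "y \<noteq> x" using ex_other[OF assms] by blast
  then show ?thesis using connected_leaving_arc[OF conn assms, of y "{x}"] arc_sym by auto
qed

lemma ex_non_neighbour:
  assumes "x \<in> V"
  shows "\<exists>y\<in>V. y \<noteq> x \<and> (x, y) \<notin> parcs G"
proof -
  obtain y where "y \<in> V" "y \<noteq> x" using ex_other[OF assms] by blast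
  then show ?thesis
    using connected_leaving_arc[OF conn', of x y "{x}"] assms arc_sym by (auto simp: complement_graph_def)
qed

text \<open>An arc leaving the closed neighbourhood of \<open>x\<close> ends at distance two from
  \<open>x\<close>, and its start is a common neighbour.\<close>

lemma mu_pos: "m > 0"
proof -
  obtain x where x: "x \<in> V" using N_ge_2 card_V by (metis card.empty equals0I not_numeral_le_zero)
  obtain y where y: "y \<in> V" "y \<noteq> x" "(x, y) \<notin> parcs G" using ex_non_neighbour[OF x] by blast
  obtain u v where uv: "u = x \<or> (x, u) \<in> parcs G" "v \<noteq> x" "(x, v) \<notin> parcs G" "(u, v) \<in> parcs G"
    using connected_leaving_arc[OF conn x y(1), of "insert x {u. (x, u) \<in> parcs G}"] y arc_sym by auto
  have xu: "(x, u) \<in> parcs G" using uv by auto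
  have v: "v \<in> V" and u: "u \<in> V" using uv(4) arc_verts by auto
  have "0 < (\<Sum>z\<in>V. adj x z * adj z v)"
    using finite_V u xu uv(4) by (intro sum_pos2[of _ u]) (auto simp: adj_def)
  also have "\<dots> = int m" using paths[OF x v] uv(2,3) by (simp add: adj_def)
  finally show ?thesis by simp
qed

text \<open>The argument of \<open>mu_pos\<close> in the complement: the left side counts the
  vertices adjacent to neither end of an edge.\<close>

lemma complement_mu_pos: "int N - 2 * int k + int l > 0"
proof -
  obtain x where x: "x \<in> V" using N_ge_2 card_V by (metis card.empty equals0I not_numeral_le_zero)
  obtain y where y: "(x, y) \<in> parcs G" using ex_neighbour[OF x] by blast
  have yV: "y \<in> V" "y \<noteq> x" using y arc_verts arc_irrefl by auto
  obtain u v where uv: "u \<in> V" "v \<in> V" "(x, u) \<notin> parcs G" "(x, v) \<in> parcs G" "(v, u) \<notin> parcs G"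
    using connected_leaving_arc[OF conn', of x y "{u. (x, u) \<notin> parcs G}"] x y yV arc_sym arc_irrefl
    by (auto simp: complement_graph_def)
  have xv: "x \<noteq> v" using uv(4) arc_irrefl by auto
  have "0 < (\<Sum>z\<in>V. (1 - adj x z) * (1 - adj v z))"
    using finite_V uv by (intro sum_pos2[of _ u]) (auto simp: adj_def)
  also have "\<dots> = (\<Sum>z\<in>V. 1 - adj x z - adj v z + adj x z * adj z v)"
    by (intro sum.cong refl) (simp add: algebra_simps adj_sym[of v])
  also have "\<dots> = int N - 2 * int k + int l"
    using degree[OF x] degree[OF uv(2)] paths[OF x uv(2)] uv(4) xv
    by (simp add: sum.distrib sum_subtractf card_V adj_def w_def)
  finally show ?thesis .
qed

lemma mu_le: "m \<le> k"
proof -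
  obtain x where x: "x \<in> V" using N_ge_2 card_V by (metis card.empty equals0I not_numeral_le_zero)
  obtain y where y: "y \<in> V" "y \<noteq> x" "(x, y) \<notin> parcs G" using ex_non_neighbour[OF x] by blast
  have "(\<Sum>z\<in>V. adj x z * adj z y) \<le> (\<Sum>z\<in>V. adj x z)" by (intro sum_mono) (simp add: adj_def)
  then show ?thesis using paths[OF x y(1)] degree[OF x] y by (simp add: adj_def)
qed

lemma N_ge_3: "N \<ge> 3"
proof -
  obtain x where x: "x \<in> V" using N_ge_2 card_V by (metis card.empty equals0I not_numeral_le_zero)
  obtain y where y: "(x, y) \<in> parcs G" using ex_neighbour[OF x] by blast
  obtain z where z: "z \<in> V" "z \<noteq> x" "(x, z) \<notin> parcs G" using ex_non_neighbour[OF x] by blast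
  have "{x, y, z} \<subseteq> V" using x y z arc_verts by auto
  moreover have "x \<noteq> y" using y arc_irrefl by blast
  moreover have "y \<noteq> z" using y z by blast
  moreover have "card {x, y, z} = 3" using calculation z by simp
  ultimately show ?thesis using card_mono[OF finite_V] card_V by metis
qed

end

section \<open>Coordinates on the two orbits and the symbol\<close>

lemma orbit_parametrization:
  assumes "permutation f" "card (orbit f x) = n"
  shows "(f ^^ n) x = x" "inj_on (\<lambda>i. (f ^^ i) x) {..<n}" "orbit f x = (\<lambda>i. (f ^^ i) x) ` {..<n}"
proof -
  have self: "x \<in> orbit f x" by (rule permutation_self_in_orbit[OF assms(1)])
  have orb: "orbit f x = (\<lambda>i. (f ^^ i) x) ` {0..<funpow_dist1 f x x}"
    by (rule orbit_conv_funpow_dist1[OF self])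
  have inj: "inj_on (\<lambda>i. (f ^^ i) x) {0..<funpow_dist1 f x x}" by (rule inj_on_funpow_dist1[OF self])
  have n: "funpow_dist1 f x x = n" using assms(2) card_image[OF inj] orb by simp
  show "(f ^^ n) x = x" using funpow_dist1_prop[OF self] n by simp
  show "inj_on (\<lambda>i. (f ^^ i) x) {..<n}" using inj n by (simp add: lessThan_atLeast0)
  show "orbit f x = (\<lambda>i. (f ^^ i) x) ` {..<n}" using orb n by (simp add: lessThan_atLeast0)
qed

locale srg_bicirculant = nontrivial_srg G N k l m for G :: "'a pair_pre_digraph" and N k l m +
  fixes f :: "'a \<Rightarrow> 'a" and n :: nat and u v :: 'a
  assumes auto: "automorphism G f" and odd_n: "odd n" and N_eq: "N = 2 * n"
    and u: "u \<in> V" and v: "v \<in> V" and V_eq: "V = orbit f u \<union> orbit f v"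
    and card_orbits: "card (orbit f u) = n" "card (orbit f v) = n"
begin

text \<open>Reducing the exponent modulo \<open>n\<close> admits negative \<open>i\<close> without
  the inverse of \<open>f\<close>.\<close>

definition rot :: "'a \<Rightarrow> int \<Rightarrow> 'a" where
  "rot x i = (f ^^ nat (i mod int n)) x"

lemma n_pos: "n > 0" using odd_n by (rule odd_pos)

lemma permutes: "f permutes V" using auto by (simp add: automorphism_def)

lemma perm: "permutation f" using permutes finite_V by (auto simp: permutation_permutes)

lemma funpow_V: "x \<in> V \<Longrightarrow> (f ^^ i) x \<in> V"
  using permutes by (induction i) (auto simp: permutes_in_image)

lemma adj_funpow:
  assumes "x \<in> V" "y \<in> V"
  shows "adj ((f ^^ i) x) ((f ^^ i) y) = adj x y"
proof (induction i)
  case (Suc i)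
  have "adj (f ((f ^^ i) x)) (f ((f ^^ i) y)) = adj ((f ^^ i) x) ((f ^^ i) y)"
    using auto funpow_V assms by (simp add: automorphism_def adj_def)
  then show ?case using Suc by simp
qed simp

lemma funpow_mod:
  assumes "x \<in> {u, v}"
  shows "(f ^^ (i mod n)) x = (f ^^ i) x"
proof -
  have "(f ^^ n) x = x" using orbit_parametrization(1)[OF perm] card_orbits assms by blast
  then show ?thesis by (rule funpow_mod_eq)
qed

lemma rot_nat: "x \<in> {u, v} \<Longrightarrow> rot x (int i) = (f ^^ i) x"
  unfolding rot_def zmod_int[symmetric] nat_int by (rule funpow_mod)

lemma rot_mod: "rot x (i mod int n) = rot x i" by (simp add: rot_def)

lemma rot_add:
  assumes "x \<in> {u, v}"
  shows "(f ^^ j) (rot x i) = rot x (i + int j)"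
proof -
  have "rot x (i + int j) = rot x (int (nat (i mod int n) + j))"
    using n_pos by (subst (1 2) rot_mod[symmetric]) (simp add: mod_add_left_eq)
  also have "\<dots> = (f ^^ (j + nat (i mod int n))) x" unfolding rot_nat[OF assms] by (simp add: add.commute)
  finally show ?thesis by (simp add: funpow_add rot_def)
qed

lemma rot_V: "x \<in> {u, v} \<Longrightarrow> rot x i \<in> V" unfolding rot_def using u v funpow_V by blast

lemma adj_rot:
  assumes "x \<in> {u, v}" "y \<in> {u, v}"
  shows "adj (rot x i) (rot y j) = adj x (rot y (j - i))"
proof -
  have "rot y j = rot y (j - i + int (nat (i mod int n)))"
    using n_pos by (subst (1 2) rot_mod[symmetric]) (simp add: mod_simps)
  also have "\<dots> = (f ^^ nat (i mod int n)) (rot y (j - i))" by (rule rot_add[OF assms(2), symmetric])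
  finally show ?thesis
    using adj_funpow[of x "rot y (j - i)" "nat (i mod int n)"] assms u v rot_V[OF assms(2)]
    unfolding rot_def[of x] by auto
qed

lemma rot_eq_self:
  assumes "x \<in> {u, v}"
  shows "x = rot x i \<longleftrightarrow> int n dvd i"
proof -
  have inj: "inj_on (\<lambda>i. (f ^^ i) x) {..<n}"
    using orbit_parametrization(2)[OF perm] card_orbits assms by blast
  have "x = rot x i \<longleftrightarrow> (f ^^ 0) x = (f ^^ nat (i mod int n)) x" by (simp add: rot_def)
  also have "\<dots> \<longleftrightarrow> 0 = nat (i mod int n)"
    using inj_on_eq_iff[OF inj, of 0 "nat (i mod int n)"] n_pos by (simp add: nat_less_iff)
  also have "\<dots> \<longleftrightarrow> int n dvd i" 
  proof -
    have "i mod int n \<ge> 0" using n_pos by simp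
    then show ?thesis unfolding dvd_eq_mod_eq_0 by linarith
  qed
  finally show ?thesis .
qed

lemma disjoint_orbits: "orbit f u \<inter> orbit f v = {}"
proof -
  have fin: "finite (orbit f u)" "finite (orbit f v)"
    using V_eq finite_V by (metis finite_Un)+
  have "card (orbit f u \<union> orbit f v) = n + n" using card_V V_eq N_eq by simp
  then have "card (orbit f u \<inter> orbit f v) = 0" using card_Un_Int[OF fin] card_orbits by simp
  then show ?thesis using fin by simp
qed

lemma sum_V: "(\<Sum>z\<in>V. F z) = (\<Sum>i<n. F (rot u (int i))) + (\<Sum>i<n. F (rot v (int i)))"
  for F :: "'a \<Rightarrow> int"
proof -
  have "(\<Sum>z\<in>orbit f x. F z) = (\<Sum>i<n. F (rot x (int i)))" if x: "x \<in> {u, v}" for x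
  proof -
    have c: "card (orbit f x) = n" using card_orbits x by blast
    show ?thesis
      unfolding orbit_parametrization(3)[OF perm c] sum.reindex[OF orbit_parametrization(2)[OF perm c]]
      by (simp add: rot_nat[OF x])
  qed
  moreover have "(\<Sum>z\<in>V. F z) = (\<Sum>z\<in>orbit f u. F z) + (\<Sum>z\<in>orbit f v. F z)"
    using disjoint_orbits V_eq finite_V by (simp add: sum.union_disjoint)
  ultimately show ?thesis by simp
qed

sublocale symbol: bicirculant_symbol n "\<lambda>g. adj u (rot u g)" "\<lambda>g. adj v (rot v g)" "\<lambda>g. adj u (rot v g)"
  "int k" "int l" "int m"
proof
  show "odd n" by (rule odd_n)
  show "n > 1" using N_ge_3 N_eq by simp
  show "periodic n (\<lambda>g. adj u (rot u g))" "periodic n (\<lambda>g. adj v (rot v g))" "periodic n (\<lambda>g. adj u (rot v g))"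
    by (simp_all add: periodic_def rot_mod)
  show "adj u (rot u g) \<in> {0..1}" "adj v (rot v g) \<in> {0..1}" for g by (simp_all add: adj_def)
  show "adj u (rot u 0) = 0" "adj v (rot v 0) = 0" by (simp_all add: rot_def)
  have minus: "adj x (rot y (- g)) = adj y (rot x g)" if "x \<in> {u, v}" "y \<in> {u, v}" for x y g
  proof -
    have "adj x (rot y (- g)) = adj (rot x g) (rot y 0)" using adj_rot[OF that, of g 0] by simp
    then show ?thesis by (simp add: rot_def[of y] adj_sym)
  qed
  show "adj u (rot u (- g)) = adj u (rot u g)" "adj v (rot v (- g)) = adj v (rot v g)" for g
    by (simp_all add: minus)
  show "(\<Sum>i<n. adj u (rot u (int i))) + (\<Sum>i<n. adj u (rot v (int i))) = int k"
    using degree[OF u] by (simp add: sum_V)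
  have T_minus: "periodic n (\<lambda>g. adj u (rot v g))" by (simp add: periodic_def rot_mod)
  have "(\<Sum>i<n. adj v (rot u (int i))) = (\<Sum>i<n. adj u (rot v (0 + (- 1) * int i)))"
    by (intro sum.cong refl) (simp add: minus)
  also have "\<dots> = (\<Sum>i<n. adj u (rot v (int i)))" by (rule sum_residues_affine[OF n_pos T_minus]) simp
  finally show "(\<Sum>i<n. adj v (rot v (int i))) + (\<Sum>i<n. adj u (rot v (int i))) = int k"
    using degree[OF v] by (simp add: sum_V)
  \<comment> \<open>Splitting the paths of length two by the orbit of the middle vertex turns
    \<open>paths\<close> into sums of convolutions.\<close>
  have path: "(\<Sum>i<n. adj x (rot u (int i)) * adj u (rot y (g - int i)))
      + (\<Sum>i<n. adj x (rot v (int i)) * adj v (rot y (g - int i)))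
      = int m + w * adj x (rot y g) + \<kappa> * of_bool (x = rot y g)" if "x \<in> {u, v}" "y \<in> {u, v}" for x y g
  proof -
    have xV: "x \<in> V" using that u v by auto
    show ?thesis using paths[OF xV rot_V[OF that(2), of g]] that by (simp add: sum_V adj_rot)
  qed
  show "convolution n (\<lambda>g. adj u (rot u g)) (\<lambda>g. adj u (rot u g)) g
      + convolution n (\<lambda>g. adj u (rot v g)) (\<lambda>h. adj u (rot v (- h))) g
      = (int l - int m) * adj u (rot u g) + (int k - int m) * of_bool (int n dvd g) + int m" for g
    using path[of u u g] by (simp add: convolution_def minus rot_eq_self w_def \<kappa>_def del: minus_diff_eq)
  show "convolution n (\<lambda>g. adj v (rot v g)) (\<lambda>g. adj v (rot v g)) g
      + convolution n (\<lambda>h. adj u (rot v (- h))) (\<lambda>g. adj u (rot v g)) g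
      = (int l - int m) * adj v (rot v g) + (int k - int m) * of_bool (int n dvd g) + int m" for g
    using path[of v v g] by (simp add: convolution_def minus rot_eq_self w_def \<kappa>_def del: minus_diff_eq)
  show "convolution n (\<lambda>g. adj u (rot u g)) (\<lambda>g. adj u (rot v g)) g
      + convolution n (\<lambda>g. adj u (rot v g)) (\<lambda>g. adj v (rot v g)) g
      = (int l - int m) * adj u (rot v g) + int m" for g
  proof -
    \<comment> \<open>The two ends lie in different orbits, so the diagonal term is absent.\<close>
    have "v \<in> orbit f v" by (rule permutation_self_in_orbit[OF perm])
    then have "rot v g \<in> orbit f v" unfolding rot_def by (rule funpow_in_orbit)
    moreover have "u \<in> orbit f u" by (rule permutation_self_in_orbit[OF perm])
    ultimately have "u \<noteq> rot v g" using disjoint_orbits by blast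
    then show ?thesis using path[of u v g] by (simp add: convolution_def w_def)
  qed
  show "int m > 0" using mu_pos by simp
  show "int m \<le> int k" using mu_le by simp
  show "2 * int n - 2 * int k + int l > 0" using complement_mu_pos N_eq by simp
qed

theorem not_locally_3_isoregular: "\<not> locally_3_isoregular G x"
proof
  assume "locally_3_isoregular G x"
  then obtain y z where y: "(x, y) \<in> parcs G" "isoregular3_pair G x y"
    and z: "z \<noteq> x" "(x, z) \<notin> parcs G" "isoregular3_pair G x z"
    by (auto simp: locally_3_isoregular_def)
  have V: "x \<in> V" "y \<in> V" "z \<in> V" using y z by (auto simp: isoregular3_pair_def)
  have xy: "adj x y = 1" "x \<noteq> y" and xz: "adj x z = 0" using y(1) z(2) arc_irrefl by (auto simp: adj_def)
  have ly: "(\<Sum>i\<in>V. adj x i * adj y i) = int l"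
    using paths[OF V(1,2)] xy by (simp add: adj_sym[of y] w_def)
  have lz: "(\<Sum>i\<in>V. adj x i * adj z i) = int m"
    using paths[OF V(1,3)] xz z(1) by (simp add: adj_sym[of z])
  \<comment> \<open>\<open>isoregular_pair_counts\<close> needs a common neighbour of the pair:
    adjacent vertices have one only if \<open>l > 0\<close>, whereas \<open>m > 0\<close> always
    holds.\<close>
  have edge: "\<exists>a b c. isoregular_counts (2 * int n) (int k) (int l) (int m) 1 (int l) a b c" if "l > 0"
    using isoregular_pair_counts[OF y(2)] ly that xy by (simp add: N_eq w_def)
  have non_edge: "\<exists>a b c. isoregular_counts (2 * int n) (int k) (int l) (int m) 0 (int m) a b c"
    using isoregular_pair_counts[OF z(3)] lz mu_pos xz by (simp add: N_eq)
  consider s where "int n = 2 * s\<^sup>2 + 2 * s + 1" "int k = s * (2 * s + 1)" "int l = s\<^sup>2 - 1" "int m = s\<^sup>2"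
    | "int n = 25" "int k = 7" "int l = 0" "int m = 1"
    | "int n = 25" "int k = 42" "int l = 35" "int m = 36"
    using symbol.parameters by blast
  then show False
  proof cases
    case (1 s)
    have "s \<noteq> 0" "s \<noteq> -1" using 1(1) symbol.n_gt_1 by auto
    then have even: "s \<noteq> -2 \<Longrightarrow> even s"
      using non_edge nonadjacent_counts_imp_even unfolding 1 by blast
    \<comment> \<open>For \<open>s = 1\<close>, the Petersen parameters, \<open>l\<close> is 0 and
      the non-edge alone is contradictory. Otherwise the edge makes \<open>s\<close> odd and the
      non-edge makes it even; the value -2, not covered by the latter, is even anyway.\<close>
    show False
    proof (cases "s = 1")
      case True
      then show False using even by simp
    next
      case False
      then have s2: "s \<ge> 2 \<or> s \<le> -2" using \<open>s \<noteq> 0\<close> \<open>s \<noteq> -1\<close> by linarith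
      then have "\<bar>s\<bar> > 1" by linarith
      then have "s\<^sup>2 > 1" using one_less_power[of "\<bar>s\<bar>" 2] by simp
      then have "l > 0" using 1(3) by linarith
      then have "odd s" using edge adjacent_counts_imp_odd[OF _ s2] unfolding 1 by blast
      then show False using even by (cases "s = -2") auto
    qed
  next
    case 2
    then show False using non_edge Hoffman_Singleton_counts by simp
  next
    case 3
    then show False using edge complement_Hoffman_Singleton_counts by simp
  qed
qed

end

theorem theorem4p3:
  fixes G :: "'a pair_pre_digraph" and n N k l m :: nat
  assumes "odd n"
    and "strongly_regular G N k l m"
    and "nontrivial G"
    and "bicirculant n G"
  shows "\<forall>x \<in> pverts G. \<not> locally_3_isoregular G x"
proof -
  obtain f where f: "automorphism G f" "card (orbit f ` pverts G) = 2"
    "\<And>C. C \<in> orbit f ` pverts G \<Longrightarrow> card C = n" and card: "card (pverts G) = 2 * n"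
    using assms(4) by (auto simp: bicirculant_def)
  have N: "N = 2 * n" using assms(2) card by (simp add: strongly_regular_def)
  have fin: "finite (pverts G)" using card odd_pos[OF assms(1)] by (intro card_ge_0_finite) simp
  obtain A B where AB: "orbit f ` pverts G = {A, B}" using f(2) by (auto simp: card_2_iff)
  then obtain u where u: "u \<in> pverts G" "A = orbit f u" by blast
  obtain v where v: "v \<in> pverts G" "B = orbit f v" using AB by blast
  have perm: "f permutes pverts G" using f(1) by (simp add: automorphism_def)
  have "pverts G = orbit f u \<union> orbit f v"
  proof (intro equalityI subsetI)
    fix x assume "x \<in> pverts G"
    moreover have "x \<in> orbit f x"
      using perm fin by (intro permutation_self_in_orbit) (auto simp: permutation_permutes)
    ultimately show "x \<in> orbit f u \<union> orbit f v" using AB u v by blast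
  next
    fix x assume "x \<in> orbit f u \<union> orbit f v"
    then show "x \<in> pverts G" using permutes_orbit_subset[OF perm] u v by blast
  qed
  moreover have "card (orbit f u) = n" "card (orbit f v) = n" using f(3) u v by auto
  ultimately interpret srg_bicirculant G N k l m f n u v
    using assms f(1) u v N odd_pos[OF assms(1)] by unfold_locales auto
  show ?thesis using not_locally_3_isoregular by blast
qed

end
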